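(* Let $\overrightarrow{\mathcal G}$ be an acyclic orientation of a $d$-rigid graph $\mathcal G$ with $n\ge d$ vertices. Then the following are equivalent: (a) $\overrightarrow{\mathcal G}$ is admissible; (b) the defect of $\overrightarrow{\mathcal G}$ is exactly $\binom{d+1}{2}$; (c) $\overrightarrow{\mathcal G}$ is formed from a directed complete subgraph $\overrightarrow{\mathcal H}$ on $d$ vertices by a (possibly empty) sequence of stable root extensions.
   Context: Fix $d\ge1$. Directed graphs are orientations of finite simple graphs; acyclic means without directed cycles. For a graph with vertex set $\{1,\dots,n\}$ and edge set $\mathcal E$, a configuration is $p=(p_1,\dots,p_n)\in\mathbb R^{dn}$; the distance map is $F(p)=(\|p_j-p_i\|^2)_{ij\in\mathcal E}$; the rigidity matrix $R(p)\in\mathbb R^{|\mathcal E|\times dn}$ has, in the row of edge $ij$, the block $(p_i-p_j)^\top$ at vertex $i$, $(p_j-p_i)^\top$ at vertex $j$, and zeros elsewhere. The graph is (generically) $d$-rigid if for generic $p$ every $q$ sufficiently close to $p$ with $F(q)=F(p)$ is congruent to $p$. Given an orientation, $\overrightarrow R(p)$ is obtained from $R(p)$ by keeping, in the row of $\overrightarrow{ij}$ (tail $i$, head $j$), only the block at the tail $i$. The edge operator is $Z(p)=2R(p)\overrightarrow R(p)^\top$; its image lies in $\operatorname{im}R(p)$. "For every generic $p$" means for all $p$ outside some proper algebraic subset of $\mathbb R^{dn}$ defined over $\mathbb Q$. A directed graph is admissible if its underlying graph is $d$-rigid and, for every generic $p$, $Z(p)|_{\operatorname{im}R(p)}$ is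 invertible. The defect of a vertex $i$ is $\delta_i=\max\{0,d-\overrightarrow{\deg}(i)\}$, where $\overrightarrow{\deg}(i)$ is its out-degree; the defect of an acyclic directed graph is the sum of its vertex defects. Let $\overrightarrow{\mathcal H}\subseteq\overrightarrow{\mathcal G}$ be a vertex-induced subgraph, and let $\overrightarrow{\mathcal G}\setminus\overrightarrow{\mathcal H}$ be the subgraph induced by the remaining vertices. $\overrightarrow{\mathcal G}$ is a root extension of $\overrightarrow{\mathcal H}$ if $\overrightarrow{\mathcal G}\setminus\overrightarrow{\mathcal H}$ is acyclic and there are no directed edges from a vertex of $\overrightarrow{\mathcal H}$ to a vertex of $\overrightarrow{\mathcal G}\setminus\overrightarrow{\mathcal H}$. It is a stable root extension if, in addition, $\overrightarrow{\mathcal H}$ is admissible and every vertex of $\overrightarrow{\mathcal G}\setminus\overrightarrow{\mathcal H}$ has out-degree (in $\overrightarrow{\mathcal G}$) at least $d$. *)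

theory Defs
  imports "HOL-Analysis.Analysis" "Graph_Theory.Graph_Theory"
begin

text \<open>
  The dimension is \<open>d = CARD('d)\<close>, hence \<open>d \<ge> 1\<close>. Digraphs are those of the AFP entry
  Graph_Theory, with arcs given as pairs (tail, head); a finite simple graph is a
  \<open>pair_graph\<close>, i.e. a finite loop-free symmetric digraph, and \<open>mk_symmetric\<close> is the
  underlying undirected graph.
\<close>

definition orientation_of :: "'v pair_pre_digraph \<Rightarrow> 'v pair_pre_digraph \<Rightarrow> bool" where
  "orientation_of D G \<longleftrightarrow>
     pair_digraph D \<and> asym (parcs D) \<and> mk_symmetric (with_proj D) = G"

definition acyclic_digraph :: "('v, 'e) pre_digraph \<Rightarrow> bool" where
  "acyclic_digraph D \<longleftrightarrow> acyclic (arcs_ends D)"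


text \<open>
  Configurations of the vertex set \<open>V\<close> are extensional functions (with the fixed value
  \<open>undefined\<close> off \<open>V\<close>), so that \<open>configs V\<close> is a copy of \<open>\<real>\<close> to the power \<open>d |V|\<close>.
  Likewise vectors indexed by arcs are extensional functions on the arc set.
\<close>

definition configs :: "'v set \<Rightarrow> ('v \<Rightarrow> real ^ 'd) set" where
  "configs V = V \<rightarrow>\<^sub>E UNIV"

inductive_set rat_polynomials :: "'v set \<Rightarrow> (('v \<Rightarrow> real ^ 'd) \<Rightarrow> real) set"
  for V :: "'v set" where
  const: "c \<in> \<rat> \<Longrightarrow> (\<lambda>p. c) \<in> rat_polynomials V"
| coord: "v \<in> V \<Longrightarrow> (\<lambda>p. p v $ k) \<in> rat_polynomials V"
| add: "f \<in> rat_polynomials V \<Longrightarrow> g \<in> rat_polynomials V \<Longrightarrow> (\<lambda>p. f p + g p) \<in> rat_polynomials V"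
| mult: "f \<in> rat_polynomials V \<Longrightarrow> g \<in> rat_polynomials V \<Longrightarrow> (\<lambda>p. f p * g p) \<in> rat_polynomials V"

definition rat_algebraic :: "'v set \<Rightarrow> ('v \<Rightarrow> real ^ 'd) set \<Rightarrow> bool" where
  "rat_algebraic V A \<longleftrightarrow>
     (\<exists>S \<subseteq> rat_polynomials V. A = {p \<in> configs V. \<forall>f\<in>S. f p = 0})"

definition for_generic :: "'v set \<Rightarrow> (('v \<Rightarrow> real ^ 'd) \<Rightarrow> bool) \<Rightarrow> bool" where
  "for_generic V P \<longleftrightarrow>
     (\<exists>A. rat_algebraic V A \<and> A \<subset> configs V \<and> (\<forall>p \<in> configs V - A. P p))"


text \<open>
  On a symmetric digraph every edge length is recorded twice, once per direction;
  this does not affect the condition \<open>F(q) = F(p)\<close>.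
\<close>

definition distance_map :: "'v pair_pre_digraph \<Rightarrow> ('v \<Rightarrow> real ^ 'd) \<Rightarrow> 'v \<times> 'v \<Rightarrow> real" where
  "distance_map G p = restrict (\<lambda>(i, j). (norm (p j - p i))\<^sup>2) (parcs G)"

definition congruent_configs :: "'v set \<Rightarrow> ('v \<Rightarrow> real ^ 'd) \<Rightarrow> ('v \<Rightarrow> real ^ 'd) \<Rightarrow> bool" where
  "congruent_configs V p q \<longleftrightarrow> (\<forall>i\<in>V. \<forall>j\<in>V. norm (q j - q i) = norm (p j - p i))"

definition rigid :: "'d::finite itself \<Rightarrow> 'v pair_pre_digraph \<Rightarrow> bool" where
  "rigid d G \<longleftrightarrow> for_generic (pverts G) (\<lambda>p :: 'v \<Rightarrow> real ^ 'd.
     \<exists>\<epsilon>>0. \<forall>q \<in> configs (pverts G).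
       (\<forall>v\<in>pverts G. dist (q v) (p v) < \<epsilon>) \<and> distance_map G q = distance_map G p \<longrightarrow>
       congruent_configs (pverts G) p q)"


text \<open>
  Matrices whose columns are indexed by vertex-coordinate pairs are written by blocks: the
  entry at row \<open>e\<close>, vertex \<open>v\<close> is the \<open>d\<close>-dimensional row block. Entries of products are
  therefore sums over \<open>v\<close> of inner products of blocks. Rows are indexed by the arcs of
  the orientation, one per edge of the underlying graph.
\<close>

definition rigidity_matrix :: "('v \<Rightarrow> real ^ 'd) \<Rightarrow> 'v \<times> 'v \<Rightarrow> 'v \<Rightarrow> real ^ 'd" where
  "rigidity_matrix p = (\<lambda>(i, j) v.
     if v = i then p i - p j else if v = j then p j - p i else 0)"

definition directed_rigidity_matrix :: "('v \<Rightarrow> real ^ 'd) \<Rightarrow> 'v \<times> 'v \<Rightarrow> 'v \<Rightarrow> real ^ 'd" where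
  "directed_rigidity_matrix p = (\<lambda>(i, j) v. if v = i then p i - p j else 0)"

definition rigidity_image :: "'v pair_pre_digraph \<Rightarrow> ('v \<Rightarrow> real ^ 'd) \<Rightarrow> ('v \<times> 'v \<Rightarrow> real) set" where
  "rigidity_image D p =
     range (\<lambda>x :: 'v \<Rightarrow> real ^ 'd.
       restrict (\<lambda>e. \<Sum>v\<in>pverts D. rigidity_matrix p e v \<bullet> x v) (parcs D))"

definition edge_matrix :: "'v pair_pre_digraph \<Rightarrow> ('v \<Rightarrow> real ^ 'd) \<Rightarrow> 'v \<times> 'v \<Rightarrow> 'v \<times> 'v \<Rightarrow> real" where
  "edge_matrix D p e f =
     2 * (\<Sum>v\<in>pverts D. rigidity_matrix p e v \<bullet> directed_rigidity_matrix p f v)"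

definition edge_operator ::
    "'v pair_pre_digraph \<Rightarrow> ('v \<Rightarrow> real ^ 'd) \<Rightarrow> ('v \<times> 'v \<Rightarrow> real) \<Rightarrow> 'v \<times> 'v \<Rightarrow> real" where
  "edge_operator D p w = restrict (\<lambda>e. \<Sum>f\<in>parcs D. edge_matrix D p e f * w f) (parcs D)"

definition admissible :: "'d::finite itself \<Rightarrow> 'v pair_pre_digraph \<Rightarrow> bool" where
  "admissible d D \<longleftrightarrow>
     rigid d (mk_symmetric (with_proj D)) \<and>
     for_generic (pverts D) (\<lambda>p :: 'v \<Rightarrow> real ^ 'd.
       bij_betw (edge_operator D p) (rigidity_image D p) (rigidity_image D p))"


text \<open>Truncated subtraction on \<open>nat\<close> gives \<open>max {0, d - deg}\<close>.\<close>

definition vertex_defect :: "'d::finite itself \<Rightarrow> 'v pair_pre_digraph \<Rightarrow> 'v \<Rightarrow> nat" where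
  "vertex_defect d D v = CARD('d) - out_degree (with_proj D) v"

definition defect :: "'d::finite itself \<Rightarrow> 'v pair_pre_digraph \<Rightarrow> nat" where
  "defect d D = (\<Sum>v\<in>pverts D. vertex_defect d D v)"


definition root_extension :: "'v pair_pre_digraph \<Rightarrow> 'v pair_pre_digraph \<Rightarrow> bool" where
  "root_extension H D \<longleftrightarrow>
     induced_subgraph (with_proj H) (with_proj D) \<and>
     acyclic_digraph (with_proj D \<restriction> (pverts D - pverts H)) \<and>
     \<not> (\<exists>u \<in> pverts H. \<exists>v \<in> pverts D - pverts H. (u, v) \<in> parcs D)"

definition stable_root_extension ::
    "'d::finite itself \<Rightarrow> 'v pair_pre_digraph \<Rightarrow> 'v pair_pre_digraph \<Rightarrow> bool" where
  "stable_root_extension d H D \<longleftrightarrow>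
     root_extension H D \<and> admissible d H \<and>
     (\<forall>v \<in> pverts D - pverts H. out_degree (with_proj D) v \<ge> CARD('d))"

end

theory Submission
  imports Defs "HOL-Computational_Algebra.Polynomial"
begin

text \<open>Write \<open>R\<close> for the rigidity matrix and \<open>L\<close> for the transpose of the directed rigidity matrix times
  \<open>R\<close>, an operator on velocity fields. The edge operator sends \<open>R x\<close> to \<open>2 R (L x)\<close>, so on the image of \<open>R\<close> it is
  bijective exactly when \<open>R (L x) = 0\<close> forces \<open>R x = 0\<close>. Since the graph is acyclic, its vertices can be
  numbered so that arcs point to smaller numbers. Then \<open>L\<close> is block triangular, and its diagonal block at a
  vertex \<open>v\<close> is the sum of \<open>a a\<^sup>T\<close> over the vectors \<open>a = p v - p w\<close> of the arcs that leave \<open>v\<close>, of rank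
  \<open>min d (outdeg v)\<close> at generic \<open>p\<close>. The out-degree of the vertex numbered \<open>i\<close> is at most \<open>i\<close>, so the defect is at least
  the sum of the numbers \<open>d - i\<close> over \<open>i < d\<close>, which is \<open>d + 1 choose 2\<close>. Equality means that every
  vertex has the least defect that its number allows; such a numbering is called tight below. It says that
  the first \<open>d\<close> vertices form a complete graph and all later ones have out-degree at least \<open>d\<close>. This is
  also what (c) says, in one single stable root extension, because such extensions preserve the defect.

  It remains to see that admissibility is tightness. The block structure alone shows that
  \<open>R (L x) = 0\<close> implies \<open>L x = 0\<close> (\<open>tail_operator_eq_zero\<close>). If the numbering is tight and \<open>L x = 0\<close>, then
  \<open>x\<close> preserves all edge lengths among the first \<open>d\<close> vertices to first order, hence agrees there with an
  infinitesimal isometry \<open>t\<close> of the whole space; and \<open>x - t\<close>, being in the kernel of \<open>L\<close> and zero on the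
  first \<open>d\<close> vertices, vanishes, because the later diagonal blocks are invertible (\<open>tight_imp_injective\<close>). If
  the numbering is not tight at \<open>k\<close>, there is a vector \<open>\<xi>\<close> in the kernel of the diagonal block of \<open>k\<close>
  which is not orthogonal to \<open>p k - p j\<close> for some earlier \<open>j\<close>. Bijectivity of the edge operator, used
  on the fields supported on vertices after \<open>k\<close>, corrects \<open>\<xi>\<close> to a field in the kernel of \<open>R\<close> which is \<open>\<xi>\<close> at
  \<open>k\<close> and zero before \<open>k\<close> (\<open>flex_extending_local_flex\<close>). It changes the distance from \<open>j\<close> to \<open>k\<close>,
  against infinitesimal rigidity (\<open>injective_imp_tight\<close>).

  That a rigid graph is infinitesimally rigid at generic \<open>p\<close> (\<open>rigid_imp_generic_infinitesimally_rigid\<close>) has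
  a short proof by averaging: if \<open>R(m) x = 0\<close>, then \<open>m + x\<close> and \<open>m - x\<close> have the same edge
  lengths. Gaussian elimination over the ring of polynomials provides fields \<open>b\<close> with polynomial entries
  that span the kernel of \<open>R(m)\<close> at generic \<open>m\<close>, and the equation \<open>p = m + s b(m)\<close> can be
  solved for \<open>m\<close> by a contraction when \<open>s\<close> is small. So \<open>m - s b(m)\<close> is a configuration close to \<open>p\<close> with the edge lengths of \<open>p\<close>,
  and rigidity at \<open>p\<close> forces \<open>b(p)\<close> to preserve all distances to first order.\<close>

section \<open>Polynomial functions and generic configurations\<close>

lemma rat_polynomials_cong:
  assumes "f \<in> rat_polynomials V" and "\<And>v. v \<in> V \<Longrightarrow> p v = q v"
  shows "f p = f q"
  using assms by (induction) auto

lemma rat_polynomials_restrict: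
  "f \<in> rat_polynomials V \<Longrightarrow> f (restrict p V) = f p"
  by (rule rat_polynomials_cong) auto

lemma rat_polynomials_diff:
  assumes "f \<in> rat_polynomials V" and "g \<in> rat_polynomials V"
  shows "(\<lambda>p. f p - g p) \<in> rat_polynomials V"
proof -
  have "(\<lambda>p. f p + (- 1) * g p) \<in> rat_polynomials V"
    by (intro rat_polynomials.intros assms) simp
  then show ?thesis by simp
qed

lemma rat_polynomials_sum:
  assumes "\<And>i. i \<in> I \<Longrightarrow> f i \<in> rat_polynomials V"
  shows "(\<lambda>p. \<Sum>i\<in>I. f i p) \<in> rat_polynomials V"
proof (cases "finite I")
  case True
  then show ?thesis using assms
    by (induction I rule: finite_induct) (auto intro!: rat_polynomials.intros)
qed (auto intro: rat_polynomials.const)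

lemma rat_polynomials_prod:
  assumes "\<And>i. i \<in> I \<Longrightarrow> f i \<in> rat_polynomials V"
  shows "(\<lambda>p. \<Prod>i\<in>I. f i p) \<in> rat_polynomials V"
proof (cases "finite I")
  case True
  then show ?thesis using assms
    by (induction I rule: finite_induct) (auto intro!: rat_polynomials.intros)
qed (auto intro: rat_polynomials.const)

lemma rat_polynomials_inner:
  assumes "\<And>k. (\<lambda>p. f p $ k) \<in> rat_polynomials V" and "\<And>k. (\<lambda>p. g p $ k) \<in> rat_polynomials V"
  shows "(\<lambda>p. f p \<bullet> (g p :: real ^ 'd)) \<in> rat_polynomials V"
  unfolding inner_vec_def by (auto intro!: rat_polynomials_sum rat_polynomials.mult assms)

text \<open>Restriction to lines reduces the absence of zero divisors among polynomial functions to polynomials in one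
  variable.\<close>

lemma rat_polynomials_line:
  assumes "f \<in> rat_polynomials V"
  shows "\<exists>P :: real poly. \<forall>t. f (\<lambda>v. p v + t *\<^sub>R (q v - p v)) = poly P t"
  using assms
proof induction
  case (const c)
  show ?case by (rule exI[of _ "[:c:]"]) simp
next
  case (coord v k)
  show ?case by (rule exI[of _ "[:p v $ k, q v $ k - p v $ k:]"]) simp
next
  case (add f g)
  then obtain P Q where "\<forall>t. f (\<lambda>v. p v + t *\<^sub>R (q v - p v)) = poly P t"
    "\<forall>t. g (\<lambda>v. p v + t *\<^sub>R (q v - p v)) = poly Q t" by blast
  then show ?case by (intro exI[of _ "P + Q"]) simp
next
  case (mult f g)
  then obtain P Q where "\<forall>t. f (\<lambda>v. p v + t *\<^sub>R (q v - p v)) = poly P t"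
    "\<forall>t. g (\<lambda>v. p v + t *\<^sub>R (q v - p v)) = poly Q t" by blast
  then show ?case by (intro exI[of _ "P * Q"]) simp
qed

lemma rat_polynomials_mult_nonzero:
  assumes f: "f \<in> rat_polynomials V" "f p \<noteq> 0" and g: "g \<in> rat_polynomials V" "g q \<noteq> 0"
  shows "\<exists>r. f r * g r \<noteq> 0"
proof -
  obtain P where P: "\<And>t. f (\<lambda>v. p v + t *\<^sub>R (q v - p v)) = poly P t"
    using rat_polynomials_line[OF f(1)] by blast
  obtain Q where Q: "\<And>t. g (\<lambda>v. p v + t *\<^sub>R (q v - p v)) = poly Q t"
    using rat_polynomials_line[OF g(1)] by blast
  have "P \<noteq> 0" using P[of 0] f(2) by auto
  moreover have "Q \<noteq> 0" using Q[of 1] g(2) by auto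
  ultimately have "P * Q \<noteq> 0" by simp
  then obtain t where "poly (P * Q) t \<noteq> 0"
    using poly_all_0_iff_0 by blast
  then show ?thesis using P[of t] Q[of t] by (metis poly_mult)
qed

text \<open>One nonzero polynomial among the equations of a proper algebraic set already serves as a certificate of
  genericity. Its value depends on the coordinates in \<open>V\<close> only, so the point where it does not vanish need
  not be an element of \<open>configs V\<close>.\<close>

lemma for_generic_iff:
  "for_generic V P \<longleftrightarrow>
     (\<exists>h \<in> rat_polynomials V. (\<exists>p. h p \<noteq> 0) \<and> (\<forall>p \<in> configs V. h p \<noteq> 0 \<longrightarrow> P p))"
proof
  assume "for_generic V P"
  then obtain S where S: "S \<subseteq> rat_polynomials V"
      "{p \<in> configs V. \<forall>f\<in>S. f p = 0} \<subset> configs V"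
      "\<forall>p \<in> configs V - {p \<in> configs V. \<forall>f\<in>S. f p = 0}. P p"
    unfolding for_generic_def rat_algebraic_def by blast
  then obtain p f where "f \<in> S" "f p \<noteq> 0" by blast
  then show "\<exists>h \<in> rat_polynomials V. (\<exists>p. h p \<noteq> 0) \<and> (\<forall>p \<in> configs V. h p \<noteq> 0 \<longrightarrow> P p)"
    using S(1,3) by (intro bexI[of _ f]) blast+
next
  assume "\<exists>h \<in> rat_polynomials V. (\<exists>p. h p \<noteq> 0) \<and> (\<forall>p \<in> configs V. h p \<noteq> 0 \<longrightarrow> P p)"
  then obtain h p where h: "h \<in> rat_polynomials V" "h p \<noteq> 0"
    "\<And>p. p \<in> configs V \<Longrightarrow> h p \<noteq> 0 \<Longrightarrow> P p" by blast
  let ?A = "{p \<in> configs V. \<forall>f\<in>{h}. f p = 0}"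
  have "restrict p V \<in> configs V" by (simp add: configs_def)
  moreover have "h (restrict p V) \<noteq> 0" using h rat_polynomials_restrict by metis
  ultimately have "?A \<subset> configs V" by blast
  moreover have "rat_algebraic V ?A"
    unfolding rat_algebraic_def using h(1) by (intro exI[of _ "{h}"]) auto
  ultimately show "for_generic V P"
    unfolding for_generic_def using h(3) by blast
qed

lemma for_genericI:
  assumes "h \<in> rat_polynomials V" and "h q \<noteq> 0" and "\<And>p. p \<in> configs V \<Longrightarrow> h p \<noteq> 0 \<Longrightarrow> P p"
  shows "for_generic V P"
  using assms unfolding for_generic_iff by blast

lemma for_generic_mono:
  assumes "for_generic V P" and "\<And>p. p \<in> configs V \<Longrightarrow> P p \<Longrightarrow> Q p"
  shows "for_generic V Q"
  using assms unfolding for_generic_iff by blast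

lemma for_generic_conj:
  assumes "for_generic V P" and "for_generic V Q"
  shows "for_generic V (\<lambda>p. P p \<and> Q p)"
proof -
  obtain f p where f: "f \<in> rat_polynomials V" "f p \<noteq> 0" "\<forall>p \<in> configs V. f p \<noteq> 0 \<longrightarrow> P p"
    using assms(1) unfolding for_generic_iff by blast
  obtain g q where g: "g \<in> rat_polynomials V" "g q \<noteq> 0" "\<forall>p \<in> configs V. g p \<noteq> 0 \<longrightarrow> Q p"
    using assms(2) unfolding for_generic_iff by blast
  obtain r where "f r * g r \<noteq> 0"
    using rat_polynomials_mult_nonzero f(1,2) g(1,2) by blast
  then show ?thesis
    by (rule for_genericI[rotated]) (use f g in \<open>auto intro: rat_polynomials.mult\<close>)
qed

lemma for_generic_const:
  assumes "\<And>p. p \<in> configs V \<Longrightarrow> P p"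
  shows "for_generic V P"
  by (rule for_genericI[of "\<lambda>p. 1"]) (auto intro: rat_polynomials.const assms)

lemma for_generic_ball:
  assumes "finite I" and "\<And>i. i \<in> I \<Longrightarrow> for_generic V (P i)"
  shows "for_generic V (\<lambda>p. \<forall>i\<in>I. P i p)"
  using assms
proof (induction I rule: finite_induct)
  case empty
  show ?case by (rule for_generic_const) simp
next
  case (insert i I)
  then have "for_generic V (\<lambda>p. P i p \<and> (\<forall>i\<in>I. P i p))"
    by (intro for_generic_conj) auto
  then show ?case by (rule for_generic_mono) auto
qed

lemma for_generic_obtain:
  assumes "for_generic V P"
  obtains p where "p \<in> configs V" and "P p"
proof -
  obtain h p where h: "h \<in> rat_polynomials V" "h p \<noteq> 0" "\<forall>p \<in> configs V. h p \<noteq> 0 \<longrightarrow> P p"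
    using assms unfolding for_generic_iff by blast
  have "restrict p V \<in> configs V" by (simp add: configs_def)
  with h that show thesis using rat_polynomials_restrict by metis
qed

section \<open>Polynomial kernels of matrices with polynomial entries\<close>

text \<open>Gaussian elimination without division, with the equations treated one at a time. If \<open>a i\<close> is the value of
  the new equation on the field \<open>b i\<close> and \<open>a j\<close> is not the zero polynomial, then the fields
  \<open>a j b i - a i b j\<close> for \<open>i \<noteq> j\<close> solve it as well, and they span its solutions wherever \<open>a j\<close> does not
  vanish. The fields satisfy the equations at every configuration, whereas they need to span only at generic ones.\<close>

lemma polynomial_kernel_basis:
  fixes row :: "'e \<Rightarrow> ('v \<Rightarrow> real ^ 'd::finite) \<Rightarrow> 'v \<Rightarrow> real ^ 'd"
  assumes "finite E" and V: "finite V"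
    and "\<And>e v k. e \<in> E \<Longrightarrow> v \<in> V \<Longrightarrow> (\<lambda>p. row e p v $ k) \<in> rat_polynomials V"
  shows "\<exists>(I :: ('v \<times> 'd) set) b h. finite I \<and>
    (\<forall>i\<in>I. \<forall>v\<in>V. \<forall>k. (\<lambda>p. b i p v $ k) \<in> rat_polynomials V) \<and>
    (\<forall>i\<in>I. \<forall>e\<in>E. \<forall>p. (\<Sum>v\<in>V. row e p v \<bullet> b i p v) = 0) \<and>
    h \<in> rat_polynomials V \<and> (\<exists>p. h p \<noteq> 0) \<and>
    (\<forall>p x. h p \<noteq> 0 \<longrightarrow> (\<forall>e\<in>E. (\<Sum>v\<in>V. row e p v \<bullet> x v) = 0) \<longrightarrow>
       (\<exists>c. \<forall>v\<in>V. x v = (\<Sum>i\<in>I. c i *\<^sub>R b i p v)))"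
  using assms(1,3)
proof (induction E rule: finite_induct)
  case empty
  define b where "b = (\<lambda>(w :: 'v, k :: 'd) (p :: 'v \<Rightarrow> real ^ 'd) v. if v = w then axis k (1::real) else (0 :: real ^ 'd))"
  have "\<exists>c. \<forall>v\<in>V. x v = (\<Sum>i\<in>V \<times> UNIV. c i *\<^sub>R b i p v)" for p and x :: "'v \<Rightarrow> real ^ 'd"
  proof (intro exI ballI)
    fix v assume v: "v \<in> V"
    have "(\<Sum>i\<in>V \<times> UNIV. (\<lambda>(w, k). x w $ k) i *\<^sub>R b i p v)
        = (\<Sum>w\<in>V. \<Sum>k\<in>UNIV. x w $ k *\<^sub>R (if v = w then axis k 1 else 0))"
      by (simp add: sum.cartesian_product b_def case_prod_unfold)
    also have "\<dots> = (\<Sum>w\<in>V. if v = w then (\<Sum>k\<in>UNIV. x w $ k *\<^sub>R axis k 1) else 0)"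
      by (intro sum.cong) auto
    also have "\<dots> = (\<Sum>k\<in>UNIV. x v $ k *\<^sub>R axis k 1)"
      using V v by (simp add: sum.delta')
    also have "\<dots> = x v"
      using basis_expansion[of "x v"] by (simp add: scalar_mult_eq_scaleR)
    finally show "x v = (\<Sum>i\<in>V \<times> UNIV. (\<lambda>(w, k). x w $ k) i *\<^sub>R b i p v)" ..
  qed
  moreover have "(\<lambda>p. b i p v $ k) \<in> rat_polynomials V" for i v k
    by (auto simp: b_def axis_def split: prod.split intro!: rat_polynomials.const)
  ultimately show ?case
    using V by (intro exI[of _ "V \<times> UNIV"] exI[of _ b] exI[of _ "\<lambda>p. 1"])
      (auto intro: rat_polynomials.const)
next
  case (insert e E)
  have "\<exists>(I :: ('v \<times> 'd) set) b h. finite I \<and>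
    (\<forall>i\<in>I. \<forall>v\<in>V. \<forall>k. (\<lambda>p. b i p v $ k) \<in> rat_polynomials V) \<and>
    (\<forall>i\<in>I. \<forall>e\<in>E. \<forall>p. (\<Sum>v\<in>V. row e p v \<bullet> b i p v) = 0) \<and>
    h \<in> rat_polynomials V \<and> (\<exists>p. h p \<noteq> 0) \<and>
    (\<forall>p x. h p \<noteq> 0 \<longrightarrow> (\<forall>e\<in>E. (\<Sum>v\<in>V. row e p v \<bullet> x v) = 0) \<longrightarrow>
       (\<exists>c. \<forall>v\<in>V. x v = (\<Sum>i\<in>I. c i *\<^sub>R b i p v)))"
    by (rule insert.IH) (rule insert.prems, simp_all)
  then obtain I :: "('v \<times> 'd) set" and b h where I: "finite I"
    and b_: "\<forall>i\<in>I. \<forall>v\<in>V. \<forall>k. (\<lambda>p. b i p v $ k) \<in> rat_polynomials V"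
    and b0_: "\<forall>i\<in>I. \<forall>e\<in>E. \<forall>p. (\<Sum>v\<in>V. row e p v \<bullet> b i p v) = 0"
    and h: "h \<in> rat_polynomials V" "\<exists>p. h p \<noteq> 0"
    and ker: "\<forall>p x. h p \<noteq> 0 \<longrightarrow> (\<forall>e\<in>E. (\<Sum>v\<in>V. row e p v \<bullet> x v) = 0) \<longrightarrow>
       (\<exists>c. \<forall>v\<in>V. x v = (\<Sum>i\<in>I. c i *\<^sub>R b i p v))"
    by (elim exE conjE) (rule that, (assumption | rule exI)+)
  note b = b_[rule_format] and b0 = b0_[rule_format] and ker = ker[rule_format]
  define a where "a i p = (\<Sum>v\<in>V. row e p v \<bullet> b i p v)" for i p
  have a: "a i \<in> rat_polynomials V" if "i \<in> I" for i
    unfolding a_def using that insert.prems b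
    by (intro rat_polynomials_sum rat_polynomials_inner) auto
  show ?case
  proof (cases "\<forall>i\<in>I. \<forall>p. a i p = 0")
    case True
    then have "\<forall>i\<in>I. \<forall>f\<in>insert e E. \<forall>p. (\<Sum>v\<in>V. row f p v \<bullet> b i p v) = 0"
      using b0 by (auto simp: a_def)
    moreover have "\<forall>p x. h p \<noteq> 0 \<longrightarrow> (\<forall>f\<in>insert e E. (\<Sum>v\<in>V. row f p v \<bullet> x v) = 0) \<longrightarrow>
       (\<exists>c. \<forall>v\<in>V. x v = (\<Sum>i\<in>I. c i *\<^sub>R b i p v))"
      using ker by simp
    ultimately show ?thesis using I b_ h
      by (intro exI[of _ I] exI[of _ b] exI[of _ h] conjI)
  next
    case False
    then obtain j q where j: "j \<in> I" and q: "a j q \<noteq> 0" by blast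
    define b' where "b' i p v = a j p *\<^sub>R b i p v - a i p *\<^sub>R b j p v" for i p v
    have poly: "(\<lambda>p. b' i p v $ k) \<in> rat_polynomials V" if "i \<in> I" "v \<in> V" for i v k
      unfolding b'_def using that j
      by (simp, intro rat_polynomials_diff rat_polynomials.mult a b)
    have row_b': "(\<Sum>v\<in>V. row f p v \<bullet> b' i p v)
        = a j p * (\<Sum>v\<in>V. row f p v \<bullet> b i p v) - a i p * (\<Sum>v\<in>V. row f p v \<bullet> b j p v)" for f i p
      unfolding b'_def by (simp add: inner_diff_right sum_subtractf sum_distrib_left)
    have kern: "(\<Sum>v\<in>V. row f p v \<bullet> b' i p v) = 0" if "i \<in> I" "f \<in> insert e E" for f i p
      unfolding row_b' using that b0 j by (cases "f = e") (auto simp: a_def)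
    define h' where "h' p = h p * a j p" for p
    have h': "h' \<in> rat_polynomials V"
      unfolding h'_def using h(1) a[OF j] by (rule rat_polynomials.mult)
    obtain p' where p': "h' p' \<noteq> 0"
      unfolding h'_def using h rat_polynomials_mult_nonzero[OF h(1) _ a[OF j] q] by blast
    have span: "\<exists>c. \<forall>v\<in>V. x v = (\<Sum>i\<in>I - {j}. c i *\<^sub>R b' i p v)"
      if p: "h' p \<noteq> 0" and x: "\<forall>f\<in>insert e E. (\<Sum>v\<in>V. row f p v \<bullet> x v) = 0" for p x
    proof -
      have nz: "h p \<noteq> 0" "a j p \<noteq> 0" using p by (auto simp: h'_def)
      obtain c where c: "\<And>v. v \<in> V \<Longrightarrow> x v = (\<Sum>i\<in>I. c i *\<^sub>R b i p v)"
        using ker[OF nz(1), of x] x by auto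
      have "0 = (\<Sum>v\<in>V. row e p v \<bullet> (\<Sum>i\<in>I. c i *\<^sub>R b i p v))"
        using x c by simp
      also have "\<dots> = (\<Sum>i\<in>I. c i * a i p)"
        by (simp add: a_def inner_sum_right sum_distrib_left sum.swap[of _ V])
      also have "\<dots> = c j * a j p + (\<Sum>i\<in>I - {j}. c i * a i p)"
        using I j by (simp add: sum.remove)
      finally have "0 = c j * a j p + (\<Sum>i\<in>I - {j}. c i * a i p)" .
      have cj: "c j = - (\<Sum>i\<in>I - {j}. c i / a j p * a i p)"
      proof -
        have "c j * a j p = (- (\<Sum>i\<in>I - {j}. c i / a j p * a i p)) * a j p"
          using \<open>0 = c j * a j p + _\<close> nz(2) by (simp add: sum_distrib_right)
        then show ?thesis using nz(2) by (metis mult_right_cancel)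
      qed
      have "x v = (\<Sum>i\<in>I - {j}. (c i / a j p) *\<^sub>R b' i p v)" if "v \<in> V" for v
      proof -
        have "x v = c j *\<^sub>R b j p v + (\<Sum>i\<in>I - {j}. c i *\<^sub>R b i p v)"
          using c[OF that] I j by (simp add: sum.remove)
        also have "\<dots> = (\<Sum>i\<in>I - {j}. c i *\<^sub>R b i p v - (c i / a j p * a i p) *\<^sub>R b j p v)"
          unfolding cj by (simp add: sum_subtractf scaleR_left.sum)
        also have "\<dots> = (\<Sum>i\<in>I - {j}. (c i / a j p) *\<^sub>R b' i p v)"
          using nz(2) by (simp add: b'_def scaleR_diff_right)
        finally show ?thesis .
      qed
      then show ?thesis by (intro exI[of _ "\<lambda>i. c i / a j p"] ballI)
    qed
    show ?thesis
    proof (intro exI conjI)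
      show "finite (I - {j})" using I by simp
      show "\<forall>i\<in>I - {j}. \<forall>v\<in>V. \<forall>k. (\<lambda>p. b' i p v $ k) \<in> rat_polynomials V"
        using poly by blast
      show "\<forall>i\<in>I - {j}. \<forall>f\<in>insert e E. \<forall>p. (\<Sum>v\<in>V. row f p v \<bullet> b' i p v) = 0"
        using kern by blast
      show "h' \<in> rat_polynomials V" "h' p' \<noteq> 0" using h' p' by simp_all
      show "\<forall>p x. h' p \<noteq> 0 \<longrightarrow> (\<forall>f\<in>insert e E. (\<Sum>v\<in>V. row f p v \<bullet> x v) = 0) \<longrightarrow>
         (\<exists>c. \<forall>v\<in>V. x v = (\<Sum>i\<in>I - {j}. c i *\<^sub>R b' i p v))"
        using span by blast
    qed
  qed
qed

section \<open>Infinitesimal change of edge lengths\<close>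

text \<open>Half of the derivative of the squared length of the edge \<open>ij\<close> at \<open>p\<close> in the direction \<open>x\<close>: the rigidity
  matrix applied to \<open>x\<close>, but available for arbitrary pairs of vertices.\<close>

definition strain :: "('v \<Rightarrow> real ^ 'd::finite) \<Rightarrow> ('v \<Rightarrow> real ^ 'd) \<Rightarrow> 'v \<times> 'v \<Rightarrow> real" where
  "strain p x = (\<lambda>(i, j). (p i - p j) \<bullet> (x i - x j))"

lemma strain_sym: "strain p x (i, j) = strain p x (j, i)"
  by (simp add: strain_def inner_diff_left inner_diff_right)

lemma strain_lincomb:
  "strain p (\<lambda>v. \<Sum>i\<in>I. c i *\<^sub>R x i v) e = (\<Sum>i\<in>I. c i * strain p (x i) e)"
  by (cases e) (simp add: strain_def inner_sum_right flip: sum_subtractf scaleR_diff_right)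

lemma strain_diff: "strain p (\<lambda>v. x v - y v) e = strain p x e - strain p y e"
  by (cases e) (simp add: strain_def inner_diff_left inner_diff_right)

lemma sum_rigidity_matrix:
  assumes "finite V" and "i \<in> V" and "j \<in> V"
  shows "(\<Sum>v\<in>V. rigidity_matrix p (i, j) v \<bullet> x v) = strain p x (i, j)"
proof -
  have "(\<Sum>v\<in>V. rigidity_matrix p (i, j) v \<bullet> x v)
      = (\<Sum>v\<in>V. (if v = i then (p i - p j) \<bullet> x i else 0) + (if v = j then (p j - p i) \<bullet> x j else 0))"
    by (intro sum.cong) (auto simp: rigidity_matrix_def)
  also have "\<dots> = strain p x (i, j)"
    using assms by (simp add: sum.distrib inner_diff_left inner_diff_right strain_def)
  finally show ?thesis .
qed

section \<open>Generic rigidity implies infinitesimal rigidity\<close>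

text \<open>Boundedness on the unit ball around \<open>p\<close> is part of the claim because the Lipschitz bound of a product
  needs the bounds of its factors.\<close>

lemma rat_polynomials_lipschitz:
  fixes p :: "'v \<Rightarrow> real ^ 'd::finite"
  assumes "f \<in> rat_polynomials V"
  shows "\<exists>K\<ge>0. \<forall>y z r. (\<forall>v\<in>V. norm (y v) \<le> 1 \<and> norm (z v) \<le> 1 \<and> dist (y v) (z v) \<le> r) \<and> 0 \<le> r \<longrightarrow>
    \<bar>f (\<lambda>v. p v + y v)\<bar> \<le> K \<and> \<bar>f (\<lambda>v. p v + y v) - f (\<lambda>v. p v + z v)\<bar> \<le> K * r"
  using assms
proof induction
  case (const c)
  show ?case by (rule exI[of _ "\<bar>c\<bar>"]) simp
next
  case (coord v k)
  have "\<bar>(p v + y v) $ k\<bar> \<le> norm (p v) + 1 \<and> \<bar>(p v + y v) $ k - (p v + z v) $ k\<bar> \<le> (norm (p v) + 1) * r"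
    if "norm (y v) \<le> 1" "dist (y v) (z v) \<le> r" "0 \<le> r" for y z :: "'v \<Rightarrow> real ^ 'd" and r
  proof
    have "\<bar>(p v + y v) $ k\<bar> \<le> norm (p v + y v)" by (rule component_le_norm_cart)
    also have "\<dots> \<le> norm (p v) + 1" using norm_triangle_ineq[of "p v" "y v"] that(1) by simp
    finally show "\<bar>(p v + y v) $ k\<bar> \<le> norm (p v) + 1" .
    have "\<bar>(p v + y v) $ k - (p v + z v) $ k\<bar> = \<bar>(y v - z v) $ k\<bar>" by simp
    also have "\<dots> \<le> norm (y v - z v)" by (rule component_le_norm_cart)
    also have "\<dots> \<le> 1 * r" using that(2) by (simp add: dist_norm)
    also have "\<dots> \<le> (norm (p v) + 1) * r" using that(3) by (intro mult_right_mono) auto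
    finally show "\<bar>(p v + y v) $ k - (p v + z v) $ k\<bar> \<le> (norm (p v) + 1) * r" .
  qed
  with coord show ?case
    by (intro exI[of _ "norm (p v) + 1"] conjI allI impI) (simp, blast, blast)
next
  case (add f g)
  then obtain K L where KL: "K \<ge> 0" "L \<ge> 0"
    and K: "\<And>y z r. (\<forall>v\<in>V. norm (y v) \<le> 1 \<and> norm (z v) \<le> 1 \<and> dist (y v) (z v) \<le> r) \<and> 0 \<le> r \<Longrightarrow>
    \<bar>f (\<lambda>v. p v + y v)\<bar> \<le> K \<and> \<bar>f (\<lambda>v. p v + y v) - f (\<lambda>v. p v + z v)\<bar> \<le> K * r"
    and L: "\<And>y z r. (\<forall>v\<in>V. norm (y v) \<le> 1 \<and> norm (z v) \<le> 1 \<and> dist (y v) (z v) \<le> r) \<and> 0 \<le> r \<Longrightarrow>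
    \<bar>g (\<lambda>v. p v + y v)\<bar> \<le> L \<and> \<bar>g (\<lambda>v. p v + y v) - g (\<lambda>v. p v + z v)\<bar> \<le> L * r"
    by blast
  show ?case
  proof (intro exI[of _ "K + L"] conjI allI impI)
    show "0 \<le> K + L" using KL by simp
    fix y z :: "'v \<Rightarrow> real ^ 'd" and r :: real
    assume "(\<forall>v\<in>V. norm (y v) \<le> 1 \<and> norm (z v) \<le> 1 \<and> dist (y v) (z v) \<le> r) \<and> 0 \<le> r"
    note K[OF this] L[OF this]
    then show "\<bar>f (\<lambda>v. p v + y v) + g (\<lambda>v. p v + y v)\<bar> \<le> K + L"
      and "\<bar>f (\<lambda>v. p v + y v) + g (\<lambda>v. p v + y v) - (f (\<lambda>v. p v + z v) + g (\<lambda>v. p v + z v))\<bar> \<le> (K + L) * r"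
      by (auto simp: distrib_right)
  qed
next
  case (mult f g)
  then obtain K L where KL: "K \<ge> 0" "L \<ge> 0"
    and K: "\<And>y z r. (\<forall>v\<in>V. norm (y v) \<le> 1 \<and> norm (z v) \<le> 1 \<and> dist (y v) (z v) \<le> r) \<and> 0 \<le> r \<Longrightarrow>
    \<bar>f (\<lambda>v. p v + y v)\<bar> \<le> K \<and> \<bar>f (\<lambda>v. p v + y v) - f (\<lambda>v. p v + z v)\<bar> \<le> K * r"
    and L: "\<And>y z r. (\<forall>v\<in>V. norm (y v) \<le> 1 \<and> norm (z v) \<le> 1 \<and> dist (y v) (z v) \<le> r) \<and> 0 \<le> r \<Longrightarrow>
    \<bar>g (\<lambda>v. p v + y v)\<bar> \<le> L \<and> \<bar>g (\<lambda>v. p v + y v) - g (\<lambda>v. p v + z v)\<bar> \<le> L * r"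
    by blast
  show ?case
  proof (intro exI[of _ "2 * K * L"] conjI allI impI)
    show "0 \<le> 2 * K * L" using KL by simp
    fix y z :: "'v \<Rightarrow> real ^ 'd" and r :: real
    assume yz: "(\<forall>v\<in>V. norm (y v) \<le> 1 \<and> norm (z v) \<le> 1 \<and> dist (y v) (z v) \<le> r) \<and> 0 \<le> r"
    then have zy: "(\<forall>v\<in>V. norm (z v) \<le> 1 \<and> norm (y v) \<le> 1 \<and> dist (z v) (y v) \<le> r) \<and> 0 \<le> r"
      by (simp add: dist_commute)
    note b = K[OF yz] L[OF yz] K[OF zy]
    define f1 f2 g1 g2 where fg: "f1 = f (\<lambda>v. p v + y v)" "f2 = f (\<lambda>v. p v + z v)"
      "g1 = g (\<lambda>v. p v + y v)" "g2 = g (\<lambda>v. p v + z v)"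
    note b = b[folded fg]
    have "\<bar>f1 * g1\<bar> \<le> K * L"
      using b KL by (simp add: abs_mult mult_mono)
    also have "\<dots> \<le> 2 * K * L" using KL by simp
    finally show "\<bar>f (\<lambda>v. p v + y v) * g (\<lambda>v. p v + y v)\<bar> \<le> 2 * K * L" by (simp add: fg)
    have "f1 * g1 - f2 * g2 = (f1 - f2) * g1 + f2 * (g1 - g2)" by (simp add: algebra_simps)
    then have "\<bar>f1 * g1 - f2 * g2\<bar> \<le> \<bar>f1 - f2\<bar> * \<bar>g1\<bar> + \<bar>f2\<bar> * \<bar>g1 - g2\<bar>"
      by (metis abs_mult abs_triangle_ineq)
    also have "\<dots> \<le> (K * r) * L + K * (L * r)"
      using b KL yz by (intro add_mono mult_mono) auto
    finally show "\<bar>f (\<lambda>v. p v + y v) * g (\<lambda>v. p v + y v) - f (\<lambda>v. p v + z v) * g (\<lambda>v. p v + z v)\<bar> \<le> 2 * K * L * r"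
      by (simp add: fg algebra_simps)
  qed
qed

lemma polynomial_field_lipschitz:
  fixes p :: "'v \<Rightarrow> real ^ 'd::finite" and b :: "('v \<Rightarrow> real ^ 'd) \<Rightarrow> 'v \<Rightarrow> real ^ 'd"
  assumes V: "finite V" and b: "\<And>v k. v \<in> V \<Longrightarrow> (\<lambda>p. b p v $ k) \<in> rat_polynomials V"
  shows "\<exists>K\<ge>0. \<forall>y z r. (\<forall>v\<in>V. norm (y v) \<le> 1 \<and> norm (z v) \<le> 1 \<and> dist (y v) (z v) \<le> r) \<and> 0 \<le> r \<longrightarrow>
    (\<forall>v\<in>V. norm (b (\<lambda>v. p v + y v) v) \<le> K \<and> dist (b (\<lambda>v. p v + y v) v) (b (\<lambda>v. p v + z v) v) \<le> K * r)"
proof -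
  let ?close = "\<lambda>y z r. (\<forall>v\<in>V. norm (y v) \<le> 1 \<and> norm (z v) \<le> 1 \<and> dist (y v) (z v) \<le> r) \<and> 0 \<le> r"
  have "\<forall>v k. \<exists>K. v \<in> V \<longrightarrow> K \<ge> 0 \<and> (\<forall>y z r. ?close y z r \<longrightarrow>
    \<bar>b (\<lambda>v. p v + y v) v $ k\<bar> \<le> K \<and> \<bar>b (\<lambda>v. p v + y v) v $ k - b (\<lambda>v. p v + z v) v $ k\<bar> \<le> K * r)"
    using rat_polynomials_lipschitz[OF b] by (intro allI) simp
  then obtain K where K_: "\<forall>v k. v \<in> V \<longrightarrow> K v k \<ge> 0 \<and> (\<forall>y z r. ?close y z r \<longrightarrow>
    \<bar>b (\<lambda>v. p v + y v) v $ k\<bar> \<le> K v k \<and> \<bar>b (\<lambda>v. p v + y v) v $ k - b (\<lambda>v. p v + z v) v $ k\<bar> \<le> K v k * r)"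
    unfolding choice_iff by (elim exE)
  have K0: "K v k \<ge> 0" if "v \<in> V" for v k using K_ that by simp
  have K: "\<bar>b (\<lambda>v. p v + y v) v $ k\<bar> \<le> K v k \<and>
      \<bar>b (\<lambda>v. p v + y v) v $ k - b (\<lambda>v. p v + z v) v $ k\<bar> \<le> K v k * r"
    if "v \<in> V" "?close y z r" for v k y z r
    using K_[rule_format, OF that(1)] that(2) by blast
  define C where "C = (\<Sum>v\<in>V. \<Sum>k\<in>UNIV. K v k)"
  have KC: "(\<Sum>k\<in>UNIV. K v k) \<le> C" if "v \<in> V" for v
    unfolding C_def using V that K0 by (intro member_le_sum) (auto intro: sum_nonneg)
  show ?thesis
  proof (intro exI[of _ C] conjI allI impI ballI)
    show "C \<ge> 0" unfolding C_def by (intro sum_nonneg K0)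
    fix y z :: "'v \<Rightarrow> real ^ 'd" and r :: real and v
    assume yz: "(\<forall>v\<in>V. norm (y v) \<le> 1 \<and> norm (z v) \<le> 1 \<and> dist (y v) (z v) \<le> r) \<and> 0 \<le> r" and v: "v \<in> V"
    have "norm (b (\<lambda>v. p v + y v) v) \<le> (\<Sum>k\<in>UNIV. \<bar>b (\<lambda>v. p v + y v) v $ k\<bar>)"
      by (rule norm_le_l1_cart)
    also have "\<dots> \<le> (\<Sum>k\<in>UNIV. K v k)" by (intro sum_mono) (use K[OF v yz] in blast)
    also have "\<dots> \<le> C" by (rule KC[OF v])
    finally show "norm (b (\<lambda>v. p v + y v) v) \<le> C" .
    have "dist (b (\<lambda>v. p v + y v) v) (b (\<lambda>v. p v + z v) v)
        \<le> (\<Sum>k\<in>UNIV. \<bar>(b (\<lambda>v. p v + y v) v - b (\<lambda>v. p v + z v) v) $ k\<bar>)"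
      unfolding dist_norm by (rule norm_le_l1_cart)
    also have "\<dots> \<le> (\<Sum>k\<in>UNIV. K v k * r)" by (intro sum_mono) (use K[OF v yz] in simp)
    also have "\<dots> \<le> C * r"
      unfolding sum_distrib_right[symmetric] using KC[OF v] yz by (intro mult_right_mono) simp_all
    finally show "dist (b (\<lambda>v. p v + y v) v) (b (\<lambda>v. p v + z v) v) \<le> C * r" .
  qed
qed

text \<open>The Banach fixed point theorem for the sup metric on \<open>V \<rightarrow>\<^sub>E UNIV\<close>, with a map that is controlled on the unit
  ball only.\<close>

lemma contraction_on_bounded_functions:
  fixes T :: "('v \<Rightarrow> 'a::euclidean_space) \<Rightarrow> 'v \<Rightarrow> 'a"
  assumes V: "finite V"
    and bound: "\<And>y v. (\<forall>v\<in>V. norm (y v) \<le> 1) \<Longrightarrow> v \<in> V \<Longrightarrow> norm (T y v) \<le> 1"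
    and contr: "\<And>y z r v. (\<forall>v\<in>V. norm (y v) \<le> 1 \<and> norm (z v) \<le> 1 \<and> dist (y v) (z v) \<le> r) \<Longrightarrow> 0 \<le> r \<Longrightarrow>
       v \<in> V \<Longrightarrow> dist (T y v) (T z v) \<le> r / 2"
  shows "\<exists>y. \<forall>v\<in>V. norm (y v) \<le> 1 \<and> T y v = y v"
proof (cases "V = {}")
  case False
  define X where "X = (Met_TC.fspace V :: ('v \<Rightarrow> 'a) set)"
  have X: "X = V \<rightarrow>\<^sub>E UNIV"
    using V by (auto simp: X_def Met_TC.fspace_def PiE_def intro: finite_imp_bounded)
  define D where "D = (Met_TC.fdist V :: ('v \<Rightarrow> 'a) \<Rightarrow> _)"
  interpret F: Metric_space X D
    unfolding X_def D_def by (simp add: Met_TC.Metric_space_funspace)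
  have complete: F.mcomplete
    using Met_TC.mcomplete_funspace[where S = V and ?'a = 'a] complete_UNIV
    by (simp add: mcomplete_of_def X_def D_def)
  have D_le: "D y z \<le> a \<longleftrightarrow> (\<forall>v\<in>V. dist (y v) (z v) \<le> a)" if "y \<in> X" "z \<in> X" for y z a
    using Met_TC.funspace_mdist_le[of y V z a] that False by (simp add: X_def D_def)
  \<comment> \<open>Projecting to the unit ball first makes the map a contraction of the complete space of
  all functions on \<open>V\<close>; its fixed point then lies in the ball.\<close>
  define P where "P = closest_point (cball (0::'a) 1)"
  have P: "norm (P x) \<le> 1" "dist (P x) (P y) \<le> dist x y" "norm x \<le> 1 \<Longrightarrow> P x = x" for x y
    using closest_point_in_set[of "cball (0::'a) 1" x] closest_point_lipschitz[of "cball (0::'a) 1" x y]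
      closest_point_self[of x "cball 0 1"]
    by (auto simp: P_def)
  obtain y where y: "y \<in> X" "restrict (T (\<lambda>v. P (y v))) V = y"
  proof (rule F.Banach_fixedpoint_thm[OF complete, where k = "1/2" and f = "\<lambda>y. restrict (T (\<lambda>v. P (y v))) V"])
    show "X \<noteq> {}" by (simp add: X PiE_eq_empty_iff)
    show "(\<lambda>y. restrict (T (\<lambda>v. P (y v))) V) \<in> X \<rightarrow> X" by (auto simp: X)
    show "D (restrict (T (\<lambda>v. P (y v))) V) (restrict (T (\<lambda>v. P (z v))) V) \<le> 1 / 2 * D y z"
      if "y \<in> X" "z \<in> X" for y z
    proof -
      have "dist (P (y v)) (P (z v)) \<le> D y z" if "v \<in> V" for v
        using D_le[of y z "D y z"] P(2)[of "y v" "z v"] that \<open>y \<in> X\<close> \<open>z \<in> X\<close> by fastforce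
      then have "dist (T (\<lambda>v. P (y v)) v) (T (\<lambda>v. P (z v)) v) \<le> D y z / 2" if "v \<in> V" for v
        using that P(1) by (intro contr) auto
      then show ?thesis by (subst D_le) (auto simp: X)
    qed
  qed auto
  have y1: "norm (y v) \<le> 1" if "v \<in> V" for v
    using bound[of "\<lambda>v. P (y v)" v] that P(1) y(2) by (metis restrict_apply)
  have "T y v = y v" if "v \<in> V" for v
  proof -
    have "dist (T (\<lambda>v. P (y v)) v) (T y v) \<le> 0 / 2"
      using that y1 P by (intro contr) auto
    then show ?thesis using y(2) that by (metis dist_le_zero_iff div_0 restrict_apply)
  qed
  with y1 show ?thesis by blast
qed auto

text \<open>The averaging argument. The polarisation identity \<open>|a + z|\<^sup>2 - |a - z|\<^sup>2 = 4 a \<bullet> z\<close>, applied to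
  \<open>a = m j - m i\<close> and \<open>z = s (b m j - b m i)\<close>, turns the flex \<open>b m\<close> of the midpoint \<open>m\<close> into an exact
  equality of edge lengths between \<open>m + s b(m)\<close> and \<open>m - s b(m)\<close>. Solving \<open>m + s b(m) = p\<close> for
  \<open>m\<close> makes the first of them the given configuration, at which rigidity is known.\<close>

lemma rigid_at_imp_flex_field_isometric:
  fixes p :: "'v \<Rightarrow> real ^ 'd::finite" and b :: "('v \<Rightarrow> real ^ 'd) \<Rightarrow> 'v \<Rightarrow> real ^ 'd"
  assumes V: "finite V" and E: "E \<subseteq> V \<times> V"
    and \<epsilon>: "\<epsilon> > 0"
    and rigid: "\<And>q. q \<in> configs V \<Longrightarrow> (\<And>v. v \<in> V \<Longrightarrow> dist (q v) (p v) < \<epsilon>) \<Longrightarrow>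
      (\<And>i j. (i, j) \<in> E \<Longrightarrow> norm (q j - q i) = norm (p j - p i)) \<Longrightarrow> congruent_configs V p q"
    and b: "\<And>v k. v \<in> V \<Longrightarrow> (\<lambda>p. b p v $ k) \<in> rat_polynomials V"
    and flex: "\<And>m e. e \<in> E \<Longrightarrow> strain m (b m) e = 0"
    and u: "u \<in> V" and w: "w \<in> V"
  shows "strain p (b p) (u, w) = 0"
proof (rule ccontr)
  define g where "g m = strain m (b m) (u, w)" for m
  assume "strain p (b p) (u, w) \<noteq> 0"
  then have g_p: "\<bar>g p\<bar> > 0" by (simp add: g_def)
  have g: "g \<in> rat_polynomials V"
    unfolding g_def strain_def prod.case using u w b
    by (intro rat_polynomials_inner) (simp_all add: rat_polynomials_diff rat_polynomials.coord)
  have ex: "\<exists>K\<ge>0. \<forall>y z r. (\<forall>v\<in>V. norm (y v) \<le> 1 \<and> norm (z v) \<le> 1 \<and> dist (y v) (z v) \<le> r) \<and> 0 \<le> r \<longrightarrow>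
    (\<forall>v\<in>V. norm (b (\<lambda>v. p v + y v) v) \<le> K \<and> dist (b (\<lambda>v. p v + y v) v) (b (\<lambda>v. p v + z v) v) \<le> K * r)"
    by (rule polynomial_field_lipschitz[OF V]) (rule b)
  obtain K where K0: "K \<ge> 0" and K_: "\<forall>y z r. (\<forall>v\<in>V. norm (y v) \<le> 1 \<and> norm (z v) \<le> 1 \<and> dist (y v) (z v) \<le> r) \<and> 0 \<le> r \<longrightarrow>
    (\<forall>v\<in>V. norm (b (\<lambda>v. p v + y v) v) \<le> K \<and> dist (b (\<lambda>v. p v + y v) v) (b (\<lambda>v. p v + z v) v) \<le> K * r)"
    using ex by (elim exE conjE)
  have K: "norm (b (\<lambda>v. p v + y v) v) \<le> K \<and> dist (b (\<lambda>v. p v + y v) v) (b (\<lambda>v. p v + z v) v) \<le> K * r"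
    if "\<forall>v\<in>V. norm (y v) \<le> 1 \<and> norm (z v) \<le> 1 \<and> dist (y v) (z v) \<le> r" "0 \<le> r" "v \<in> V" for y z r v
    using K_[rule_format, of y z r v] that by simp
  obtain L where L0: "L \<ge> 0" and L_: "\<forall>y z r. (\<forall>v\<in>V. norm (y v) \<le> 1 \<and> norm (z v) \<le> 1 \<and> dist (y v) (z v) \<le> r) \<and> 0 \<le> r \<longrightarrow>
    \<bar>g (\<lambda>v. p v + y v)\<bar> \<le> L \<and> \<bar>g (\<lambda>v. p v + y v) - g (\<lambda>v. p v + z v)\<bar> \<le> L * r"
    using rat_polynomials_lipschitz[OF g, where p = p] by (elim exE conjE)
  have L: "\<bar>g (\<lambda>v. p v + y v) - g (\<lambda>v. p v + z v)\<bar> \<le> L * r"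
    if "\<forall>v\<in>V. norm (y v) \<le> 1 \<and> norm (z v) \<le> 1 \<and> dist (y v) (z v) \<le> r" "0 \<le> r" for y z r
    using L_[rule_format, of y z r] that by simp
  \<comment> \<open>\<open>s\<close> is so small that \<open>s b\<close> is a contraction near \<open>p\<close>, that it cannot reach a zero of \<open>g\<close>
  from \<open>p\<close>, and that the second configuration stays within \<open>\<epsilon>\<close>.\<close>
  define t where "t = min (1 / 2) (min (\<bar>g p\<bar> / (2 * (L + 1))) (\<epsilon> / 4))"
  define s where "s = t / (K + 1)"
  have t0: "t > 0" unfolding t_def using L0 g_p \<epsilon> by simp
  have s0: "s > 0" unfolding s_def using K0 t0 by simp
  have "t \<le> \<bar>g p\<bar> / (2 * (L + 1))" "t \<le> 1 / 2" "t \<le> \<epsilon> / 4" unfolding t_def by linarith+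
  then have t: "2 * t \<le> 1" "2 * (t * (L + 1)) \<le> \<bar>g p\<bar>" "4 * t \<le> \<epsilon>"
    using L0 by (simp_all add: pos_le_divide_eq algebra_simps)
  have sKt: "s * K \<le> t" using t0 K0 by (simp add: s_def field_simps)
  have "L * (s * K) \<le> L * t" using sKt L0 by (rule mult_left_mono)
  moreover have "2 * (L * t) + 2 * t \<le> \<bar>g p\<bar>" using t(2) by (simp add: algebra_simps)
  moreover have "0 \<le> L * t" using L0 t0 by simp
  ultimately have sK: "s * K \<le> 1 / 2" "L * (s * K) < \<bar>g p\<bar>" "2 * (s * K) < \<epsilon>"
    using sKt t t0 by linarith+
  have "\<exists>y. \<forall>v\<in>V. norm (y v) \<le> 1 \<and> - s *\<^sub>R b (\<lambda>v. p v + y v) v = y v"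
  proof (rule contraction_on_bounded_functions[OF V])
    fix y :: "'v \<Rightarrow> real ^ 'd" and v
    assume y: "\<forall>v\<in>V. norm (y v) \<le> 1" and v: "v \<in> V"
    have "norm (- s *\<^sub>R b (\<lambda>v. p v + y v) v) \<le> s * K"
      using K[of y y 0 v] y v s0 by (simp add: mult_left_mono)
    then show "norm (- s *\<^sub>R b (\<lambda>v. p v + y v) v) \<le> 1" using sK(1) by simp
  next
    fix y z :: "'v \<Rightarrow> real ^ 'd" and v and r :: real
    assume yz: "\<forall>v\<in>V. norm (y v) \<le> 1 \<and> norm (z v) \<le> 1 \<and> dist (y v) (z v) \<le> r" and r: "0 \<le> r" and v: "v \<in> V"
    have "dist (- s *\<^sub>R b (\<lambda>v. p v + y v) v) (- s *\<^sub>R b (\<lambda>v. p v + z v) v)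
        = s * dist (b (\<lambda>v. p v + y v) v) (b (\<lambda>v. p v + z v) v)"
      using s0 by (simp add: dist_norm norm_minus_commute flip: scaleR_diff_right)
    also have "\<dots> \<le> s * (K * r)"
      using K[OF yz r v] s0 by (intro mult_left_mono) auto
    also have "\<dots> = (s * K) * r" by simp
    also have "\<dots> \<le> 1 / 2 * r" using sK(1) r by (intro mult_right_mono)
    finally show "dist (- s *\<^sub>R b (\<lambda>v. p v + y v) v) (- s *\<^sub>R b (\<lambda>v. p v + z v) v) \<le> r / 2" by simp
  qed
  then obtain y where y: "\<And>v. v \<in> V \<Longrightarrow> norm (y v) \<le> 1"
    and fix_y: "\<And>v. v \<in> V \<Longrightarrow> y v = - s *\<^sub>R b (\<lambda>v. p v + y v) v" by metis
  define m where "m v = p v + y v" for v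
  have p_m: "p v = m v + s *\<^sub>R b m v" if "v \<in> V" for v
    using fix_y[OF that] by (simp add: m_def[abs_def])
  have bK: "norm (b m v) \<le> K" if "v \<in> V" for v
    using K[of y y 0 v] y that by (simp add: m_def[abs_def])
  define q where "q = restrict (\<lambda>v. m v - s *\<^sub>R b m v) V"
  have edge: "(norm (q j - q i))\<^sup>2 = (norm (p j - p i))\<^sup>2 - 4 * s * strain m (b m) (i, j)"
    if "i \<in> V" "j \<in> V" for i j
    using that unfolding q_def p_m[OF that(1)] p_m[OF that(2)] power2_norm_eq_inner
    by (simp add: strain_def inner_diff_left inner_diff_right inner_add_left inner_add_right inner_commute algebra_simps)
  have "congruent_configs V p q"
  proof (rule rigid)
    show "q \<in> configs V" by (simp add: configs_def q_def)
    show "dist (q v) (p v) < \<epsilon>" if "v \<in> V" for v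
    proof -
      have "q v - p v = (- (2 * s)) *\<^sub>R b m v"
        using that by (simp add: q_def p_m[OF that] algebra_simps scaleR_2[symmetric])
      then have "dist (q v) (p v) = 2 * s * norm (b m v)"
        using s0 by (simp add: dist_norm)
      also have "\<dots> \<le> 2 * (s * K)" using bK[OF that] s0 by simp
      finally show ?thesis using sK(3) by simp
    qed
    show "norm (q j - q i) = norm (p j - p i)" if "(i, j) \<in> E" for i j
    proof -
      have "i \<in> V" "j \<in> V" using that E by auto
      then have "(norm (q j - q i))\<^sup>2 = (norm (p j - p i))\<^sup>2"
        using edge flex[OF that] by simp
      then show ?thesis by simp
    qed
  qed
  then have "norm (q w - q u) = norm (p w - p u)"
    using u w by (simp add: congruent_configs_def)
  then have "g m = 0" using edge[OF u w] s0 by (simp add: g_def)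
  moreover have "norm (y v) \<le> s * K" if "v \<in> V" for v
    using fix_y[OF that] bK[OF that] s0 by (simp add: m_def[abs_def, symmetric])
  then have "\<bar>g (\<lambda>v. p v + y v) - g (\<lambda>v. p v + 0)\<bar> \<le> L * (s * K)"
    using s0 K0 y by (intro L) auto
  ultimately show False using sK(2) by (simp add: m_def[abs_def])
qed

text \<open>One direction of the theorem of Asimow and Roth: the polynomial fields that span the kernel generically are
  isometric at every configuration where the graph is rigid.\<close>

theorem rigid_imp_generic_infinitesimally_rigid:
  assumes "finite (pverts G)" and E: "parcs G \<subseteq> pverts G \<times> pverts G"
    and rigid: "rigid TYPE('d::finite) G"
  shows "for_generic (pverts G) (\<lambda>p :: 'v \<Rightarrow> real ^ 'd. \<forall>x.
    (\<forall>e\<in>parcs G. strain p x e = 0) \<longrightarrow>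
    (\<forall>i\<in>pverts G. \<forall>j\<in>pverts G. strain p x (i, j) = 0))"
proof -
  let ?V = "pverts G"
  have V: "finite ?V" by fact
  have fE: "finite (parcs G)" using E V finite_subset by blast
  have rows: "(\<lambda>p :: 'v \<Rightarrow> real ^ 'd. rigidity_matrix p e v $ k) \<in> rat_polynomials ?V"
    if "e \<in> parcs G" for e v k
  proof -
    obtain i j where e: "e = (i, j)" by (cases e)
    have "i \<in> ?V" "j \<in> ?V" using that E e by auto
    then show ?thesis
      by (cases "v = i"; cases "v = j")
        (auto simp: e rigidity_matrix_def intro!: rat_polynomials_diff rat_polynomials.coord rat_polynomials.const)
  qed
  have "\<exists>(I :: ('v \<times> 'd) set) b (h :: ('v \<Rightarrow> real ^ 'd) \<Rightarrow> real). finite I \<and>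
    (\<forall>i\<in>I. \<forall>v\<in>?V. \<forall>k. (\<lambda>p. b i p v $ k) \<in> rat_polynomials ?V) \<and>
    (\<forall>i\<in>I. \<forall>e\<in>parcs G. \<forall>p :: 'v \<Rightarrow> real ^ 'd. (\<Sum>v\<in>?V. rigidity_matrix p e v \<bullet> b i p v) = 0) \<and>
    h \<in> rat_polynomials ?V \<and> (\<exists>p. h p \<noteq> 0) \<and>
    (\<forall>p x. h p \<noteq> 0 \<longrightarrow> (\<forall>e\<in>parcs G. (\<Sum>v\<in>?V. rigidity_matrix p e v \<bullet> x v) = 0) \<longrightarrow>
       (\<exists>c. \<forall>v\<in>?V. x v = (\<Sum>i\<in>I. c i *\<^sub>R b i p v)))"
    by (rule polynomial_kernel_basis[where row = "\<lambda>e p. rigidity_matrix p e", OF fE V]) (rule rows)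
  then obtain I :: "('v \<times> 'd) set" and b and h :: "('v \<Rightarrow> real ^ 'd) \<Rightarrow> real" where I: "finite I"
    and b: "\<forall>i\<in>I. \<forall>v\<in>?V. \<forall>k. (\<lambda>p. b i p v $ k) \<in> rat_polynomials ?V"
    and b0: "\<forall>i\<in>I. \<forall>e\<in>parcs G. \<forall>p :: 'v \<Rightarrow> real ^ 'd. (\<Sum>v\<in>?V. rigidity_matrix p e v \<bullet> b i p v) = 0"
    and h: "h \<in> rat_polynomials ?V" "\<exists>p. h p \<noteq> 0"
    and ker: "\<forall>p x. h p \<noteq> 0 \<longrightarrow> (\<forall>e\<in>parcs G. (\<Sum>v\<in>?V. rigidity_matrix p e v \<bullet> x v) = 0) \<longrightarrow>
       (\<exists>c. \<forall>v\<in>?V. x v = (\<Sum>i\<in>I. c i *\<^sub>R b i p v))"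
    by (elim exE conjE) (rule that, (assumption | rule exI)+)
  have row_sum: "(\<Sum>v\<in>?V. rigidity_matrix m e v \<bullet> y v) = strain m y e"
    if "e \<in> parcs G" for e and m y :: "'v \<Rightarrow> real ^ 'd"
    using that E sum_rigidity_matrix[OF V, of "fst e" "snd e" m y] by auto
  have flex: "strain m (b k m) e = 0" if "e \<in> parcs G" "k \<in> I" for m e k
    using b0 row_sum[of e m "b k m"] that by simp
  obtain q where q: "h q \<noteq> 0" using h(2) by blast
  have generic_h: "for_generic ?V (\<lambda>p. h p \<noteq> 0)"
    by (rule for_genericI[OF h(1) q])
  show ?thesis
  proof (rule for_generic_mono[OF for_generic_conj[OF rigid[unfolded rigid_def] generic_h]], intro allI impI ballI)
    fix p x u w
    assume p: "(\<exists>\<epsilon>>0. \<forall>q \<in> configs ?V. (\<forall>v\<in>?V. dist (q v) (p v) < \<epsilon>) \<and>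
        distance_map G q = distance_map G p \<longrightarrow> congruent_configs ?V p q) \<and> h p \<noteq> 0"
      and x: "\<forall>e\<in>parcs G. strain p x e = 0" and u: "u \<in> ?V" and w: "w \<in> ?V"
    obtain \<epsilon> where \<epsilon>: "\<epsilon> > 0" and local_rigid: "\<And>q. q \<in> configs ?V \<Longrightarrow>
        (\<forall>v\<in>?V. dist (q v) (p v) < \<epsilon>) \<and> distance_map G q = distance_map G p \<Longrightarrow> congruent_configs ?V p q"
      using p by blast
    have triv: "strain p (b k p) (u, w) = 0" if "k \<in> I" for k
    proof (rule rigid_at_imp_flex_field_isometric[OF V E \<epsilon> _ _ _ u w])
      show "congruent_configs ?V p q" if "q \<in> configs ?V" "\<And>v. v \<in> ?V \<Longrightarrow> dist (q v) (p v) < \<epsilon>"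
        "\<And>i j. (i, j) \<in> parcs G \<Longrightarrow> norm (q j - q i) = norm (p j - p i)" for q
        using that by (intro local_rigid) (auto simp: distance_map_def restrict_def fun_eq_iff)
    qed (use b flex that in auto)
    have "\<exists>c. \<forall>v\<in>?V. x v = (\<Sum>i\<in>I. c i *\<^sub>R b i p v)"
      using ker[rule_format, of p x] p x row_sum by simp
    then obtain c where c: "\<And>v. v \<in> ?V \<Longrightarrow> x v = (\<Sum>i\<in>I. c i *\<^sub>R b i p v)" by blast
    have "strain p x (u, w) = strain p (\<lambda>v. \<Sum>i\<in>I. c i *\<^sub>R b i p v) (u, w)"
      by (simp add: strain_def c u w)
    then show "strain p x (u, w) = 0" by (simp add: strain_lincomb triv)
  qed
qed

section \<open>Configurations in general position\<close>

text \<open>Every linear system whose rows are the vectors from at most \<open>d\<close> vertices to \<open>k\<close> is solvable. Completing these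
  rows by coordinate vectors gives a square matrix whose determinant is a polynomial, and it is the identity
  matrix when \<open>p\<close> places \<open>k\<close> at the origin and the other vertices at negated coordinate vectors.\<close>

lemma generic_interpolation:
  assumes V: "finite V" and k: "k \<in> V" and J: "J \<subseteq> V - {k}" "card J \<le> CARD('d::finite)"
  shows "for_generic V (\<lambda>p :: 'v \<Rightarrow> real ^ 'd. \<forall>\<beta>. \<exists>y. \<forall>j\<in>J. (p k - p j) \<bullet> y = \<beta> j)"
proof -
  have fJ: "finite J" using J(1) V finite_subset by blast
  obtain \<sigma> :: "'v \<Rightarrow> 'd" where \<sigma>: "inj_on \<sigma> J"
    using card_le_inj[OF fJ finite_class.finite_UNIV J(2)] by blast
  define \<tau> where "\<tau> = the_inv_into J \<sigma>"
  have \<tau>\<sigma>: "\<tau> (\<sigma> j) = j" if "j \<in> J" for j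
    unfolding \<tau>_def using that \<sigma> by (simp add: the_inv_into_f_f)
  define A :: "('v \<Rightarrow> real ^ 'd) \<Rightarrow> real ^ 'd ^ 'd"
    where "A p = (\<chi> r. if r \<in> \<sigma> ` J then p k - p (\<tau> r) else axis r 1)" for p
  have A_row: "A p $ \<sigma> j = p k - p j" if "j \<in> J" for p j
    unfolding A_def using that \<tau>\<sigma> by simp
  define q :: "'v \<Rightarrow> real ^ 'd" where "q v = (if v \<in> J then - axis (\<sigma> v) 1 else 0)" for v
  have "A q $ r = axis r 1" for r
    using J(1) \<tau>\<sigma> by (auto simp: A_def q_def)
  then have "A q = mat 1"
    by (simp add: vec_eq_iff axis_def mat_def)
  then have "det (A q) \<noteq> 0" by simp
  moreover have entry: "(\<lambda>p. A p $ r $ c) \<in> rat_polynomials V" for r c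
  proof (cases "r \<in> \<sigma> ` J")
    case True
    then have "\<tau> r \<in> V" using \<tau>\<sigma> J(1) by auto
    with True k show ?thesis
      unfolding A_def by (auto intro!: rat_polynomials_diff rat_polynomials.coord)
  next
    case False
    then show ?thesis by (auto simp: A_def axis_def intro!: rat_polynomials.const)
  qed
  have "(\<lambda>p. det (A p)) \<in> rat_polynomials V"
    unfolding det_def
    by (intro rat_polynomials_sum rat_polynomials.mult rat_polynomials_prod entry rat_polynomials.const) simp
  moreover have "\<exists>y. \<forall>j\<in>J. (p k - p j) \<bullet> y = \<beta> j" if "det (A p) \<noteq> 0" for p \<beta>
  proof -
    have "surj ((*v) (A p))"
      using that invertible_det_nz invertible_right_inverse matrix_right_invertible_surjective by blast
    then obtain y where y: "A p *v y = (\<chi> r. \<beta> (\<tau> r))" by (metis surjD)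
    have "(p k - p j) \<bullet> y = \<beta> j" if "j \<in> J" for j
    proof -
      have "(p k - p j) \<bullet> y = (A p *v y) $ \<sigma> j"
        by (simp add: matrix_vector_mul_component A_row[OF that])
      also have "\<dots> = \<beta> j" using that by (simp add: y \<tau>\<sigma>)
      finally show ?thesis .
    qed
    then show ?thesis by blast
  qed
  ultimately show ?thesis by (intro for_genericI[of "\<lambda>p. det (A p)"]) auto
qed

lemma interpolation_imp_lin_indep:
  fixes a :: "'v \<Rightarrow> 'a::real_inner"
  assumes "\<And>\<beta>. \<exists>y. \<forall>j\<in>J. a j \<bullet> y = \<beta> j" and "finite J"
    and "(\<Sum>j\<in>J. c j *\<^sub>R a j) = 0" and "i \<in> J"
  shows "c i = 0"
proof -
  obtain y where y: "\<And>j. j \<in> J \<Longrightarrow> a j \<bullet> y = (if j = i then 1 else 0)"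
    using assms(1)[of "\<lambda>j. if j = i then 1 else 0"] by blast
  have "0 = (\<Sum>j\<in>J. c j *\<^sub>R a j) \<bullet> y" using assms(3) by simp
  also have "\<dots> = (\<Sum>j\<in>J. if j = i then c j else 0)"
    using y by (auto simp: inner_sum_left intro!: sum.cong)
  also have "\<dots> = c i" using assms(2,4) by simp
  finally show ?thesis by simp
qed

text \<open>The solvability hypothesis makes a linear map from \<open>\<real>\<close> to the power \<open>d\<close> to itself surjective, hence injective.\<close>

lemma interpolation_imp_orthogonal_zero:
  fixes a :: "'v \<Rightarrow> real ^ 'd::finite"
  assumes "\<And>\<beta>. \<exists>y. \<forall>j\<in>J. a j \<bullet> y = \<beta> j" and "card J = CARD('d)"
    and "\<And>j. j \<in> J \<Longrightarrow> a j \<bullet> y = 0"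
  shows "y = 0"
proof -
  have "finite J" using assms(2) card_ge_0_finite[of J] by simp
  then obtain \<tau> :: "'d \<Rightarrow> 'v" where \<tau>: "bij_betw \<tau> UNIV J"
    using finite_same_card_bij[of "UNIV :: 'd set" J] assms(2) by auto
  define T where "T y = (\<chi> k. a (\<tau> k) \<bullet> y)" for y
  have lin: "linear T"
    by (rule linearI) (simp_all add: T_def vec_eq_iff inner_add_right)
  have "\<exists>y. T y = z" for z
  proof -
    obtain y where y: "\<And>j. j \<in> J \<Longrightarrow> a j \<bullet> y = z $ (inv_into UNIV \<tau> j)"
      using assms(1)[of "\<lambda>j. z $ (inv_into UNIV \<tau> j)"] by blast
    have "T y = z"
      using y \<tau> by (auto simp: T_def vec_eq_iff bij_betw_def)
    then show ?thesis by blast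
  qed
  then have "surj T" by (metis surjI)
  then have "inj T" using linear_surjective_imp_injective[OF lin] by blast
  moreover have "T y = T 0"
    using assms(3) \<tau> by (auto simp: T_def vec_eq_iff bij_betw_def)
  ultimately show ?thesis by (simp add: inj_eq)
qed

text \<open>If \<open>y i\<close> is a family dual to \<open>a i\<close>, the sum of the operators \<open>w i (y i)\<^sup>T - y i (w i)\<^sup>T\<close> is skew and has the
  correct values \<open>w i\<close> up to combinations of the \<open>y i\<close>. The coefficients of this error are the numbers
  \<open>w i \<bullet> a j\<close>; as they are antisymmetric by assumption, removing the error keeps the operator skew.\<close>

lemma skew_interpolation:
  fixes a w :: "'v \<Rightarrow> 'a::real_inner"
  assumes "\<And>\<beta>. \<exists>y. \<forall>j\<in>J. a j \<bullet> y = \<beta> j" and J: "finite J"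
    and skew: "\<And>i j. i \<in> J \<Longrightarrow> j \<in> J \<Longrightarrow> w i \<bullet> a j + w j \<bullet> a i = 0"
  obtains S where "linear S" and "\<And>z. z \<bullet> S z = 0" and "\<And>i. i \<in> J \<Longrightarrow> S (a i) = w i"
proof -
  have "\<exists>y. \<forall>j\<in>J. a j \<bullet> y = (if j = i then 1 else 0)" for i
    using assms(1)[of "\<lambda>j. if j = i then 1 else 0"] by blast
  then obtain y where y: "\<And>i j. j \<in> J \<Longrightarrow> a j \<bullet> y i = (if j = i then 1 else 0)"
    by metis
  define S where "S z = (\<Sum>i\<in>J. (y i \<bullet> z) *\<^sub>R w i - (w i \<bullet> z) *\<^sub>R y i)
      + (\<Sum>i\<in>J. \<Sum>j\<in>J. ((w i \<bullet> a j) * (y j \<bullet> z)) *\<^sub>R y i)" for z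
  have "linear S"
    by (rule linearI) (simp_all add: S_def inner_add_right algebra_simps sum.distrib
      sum_subtractf scaleR_right.sum)
  moreover have "z \<bullet> S z = 0" for z
  proof -
    define s where "s = (\<Sum>i\<in>J. \<Sum>j\<in>J. (w i \<bullet> a j) * (y j \<bullet> z) * (y i \<bullet> z))"
    have "s = (\<Sum>i\<in>J. \<Sum>j\<in>J. (w j \<bullet> a i) * (y i \<bullet> z) * (y j \<bullet> z))"
      unfolding s_def by (rule sum.swap)
    then have "s + s = s + (\<Sum>i\<in>J. \<Sum>j\<in>J. (w j \<bullet> a i) * (y i \<bullet> z) * (y j \<bullet> z))" by simp
    also have "\<dots> = (\<Sum>i\<in>J. \<Sum>j\<in>J. (w i \<bullet> a j + w j \<bullet> a i) * ((y j \<bullet> z) * (y i \<bullet> z)))"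
      unfolding s_def by (simp add: sum.distrib distrib_left mult_ac)
    also have "\<dots> = 0" using skew by simp
    finally have "s = 0" by simp
    moreover have "z \<bullet> S z = s"
      by (simp add: S_def s_def inner_add_right inner_sum_right inner_diff_right inner_commute mult_ac)
    ultimately show ?thesis by simp
  qed
  moreover have "S (a i) = w i" if i: "i \<in> J" for i
  proof -
    have 1: "(\<Sum>k\<in>J. (y k \<bullet> a i) *\<^sub>R w k) = w i"
      using y[OF i] J i by (simp add: inner_commute[of "y _"] if_distrib[of "\<lambda>c. c *\<^sub>R _"] cong: if_cong)
    have 2: "(\<Sum>j\<in>J. ((w k \<bullet> a j) * (y j \<bullet> a i)) *\<^sub>R y k) = (w k \<bullet> a i) *\<^sub>R y k" for k
      using y[OF i] J i by (simp add: inner_commute[of "y _"] if_distrib[of "\<lambda>c. c *\<^sub>R _"] if_distrib[of "\<lambda>c. _ * c"] cong: if_cong)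
    show ?thesis unfolding S_def 2 by (simp add: sum_subtractf 1)
  qed
  ultimately show thesis by (rule that)
qed

text \<open>Linear independence of the vectors \<open>p k - p j\<close>, indexed by \<open>j\<close> in \<open>J\<close>, in its dual form: this is the form which
  determinants provide and which produces vectors with prescribed inner products.\<close>

definition generic_position :: "'v set \<Rightarrow> ('v \<Rightarrow> real ^ 'd::finite) \<Rightarrow> bool" where
  "generic_position V p \<longleftrightarrow> (\<forall>k\<in>V. \<forall>J \<subseteq> V - {k}. card J \<le> CARD('d) \<longrightarrow>
     (\<forall>\<beta>. \<exists>y. \<forall>j\<in>J. (p k - p j) \<bullet> y = \<beta> j))"

lemma generic_positionD:
  fixes p :: "'v \<Rightarrow> real ^ 'd::finite"
  assumes "generic_position V p" and "k \<in> V" and "J \<subseteq> V - {k}" and "card J \<le> CARD('d)"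
  shows "\<exists>y. \<forall>j\<in>J. (p k - p j) \<bullet> y = \<beta> j"
  using assms unfolding generic_position_def by simp

lemma for_generic_generic_position:
  assumes "finite V"
  shows "for_generic V (generic_position V :: ('v \<Rightarrow> real ^ 'd::finite) \<Rightarrow> bool)"
proof -
  have "for_generic V (\<lambda>p :: 'v \<Rightarrow> real ^ 'd. \<forall>k\<in>V. \<forall>J\<in>{J. J \<subseteq> V - {k} \<and> card J \<le> CARD('d)}.
     \<forall>\<beta>. \<exists>y. \<forall>j\<in>J. (p k - p j) \<bullet> y = \<beta> j)"
    using assms by (intro for_generic_ball generic_interpolation) auto
  then show ?thesis by (rule for_generic_mono) (auto simp: generic_position_def)
qed

text \<open>Relative to a base point \<open>k\<close> of \<open>U\<close>, the hypothesis on \<open>x\<close> says that the velocities \<open>x k - x i\<close> are skew against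
  the vectors \<open>p k - p i\<close>, so a skew operator interpolates them, and it defines an affine field on all vertices.\<close>

lemma infinitesimal_isometry_extends:
  fixes p x :: "'v \<Rightarrow> real ^ 'd::finite"
  assumes p: "generic_position V p" and U: "U \<subseteq> V" "U \<noteq> {}" "card U \<le> CARD('d)" "finite U"
    and x: "\<And>i j. i \<in> U \<Longrightarrow> j \<in> U \<Longrightarrow> strain p x (i, j) = 0"
  obtains t where "\<And>v. v \<in> U \<Longrightarrow> t v = x v" and "\<And>i j. strain p t (i, j) = 0"
proof -
  obtain k where k: "k \<in> U" using U(2) by blast
  define J where "J = U - {k}"
  have J: "J \<subseteq> V - {k}" "card J \<le> CARD('d)" "finite J"
    using U card_mono[OF U(4), of J] by (auto simp: J_def)
  have skew: "(x k - x i) \<bullet> (p k - p j) + (x k - x j) \<bullet> (p k - p i) = 0" if "i \<in> J" "j \<in> J" for i j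
  proof -
    have "strain p x (k, i) + strain p x (k, j) - strain p x (i, j) = 0"
      using x k that by (simp add: J_def)
    then show ?thesis
      by (simp add: strain_def inner_diff_left inner_diff_right inner_commute algebra_simps)
  qed
  have interp: "\<exists>y. \<forall>j\<in>J. (p k - p j) \<bullet> y = \<beta> j" for \<beta>
    using k U(1) J(1,2) by (intro generic_positionD[OF p]) auto
  obtain S where S: "linear S" "\<And>z. z \<bullet> S z = 0" "\<And>i. i \<in> J \<Longrightarrow> S (p k - p i) = x k - x i"
    by (rule skew_interpolation[of J "\<lambda>j. p k - p j" "\<lambda>j. x k - x j", OF interp J(3)], erule (1) skew, rule that)
  define t where "t v = x k - S (p k - p v)" for v
  have "t v = x v" if "v \<in> U" for v
    using that S(3) linear_0[OF S(1)] by (cases "v = k") (auto simp: t_def J_def)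
  moreover have "strain p t (i, j) = 0" for i j
  proof -
    have "t i - t j = S (p k - p j) - S (p k - p i)" by (simp add: t_def)
    also have "\<dots> = S ((p k - p j) - (p k - p i))" by (rule linear_diff[OF S(1), symmetric])
    finally have "t i - t j = S (p i - p j)" by simp
    then show ?thesis using S(2)[of "p i - p j"] by (simp add: strain_def)
  qed
  ultimately show thesis by (rule that)
qed

section \<open>The edge operator as an operator on velocity fields\<close>

definition out_nbrs :: "'v pair_pre_digraph \<Rightarrow> 'v \<Rightarrow> 'v set" where
  "out_nbrs D v = {w. (v, w) \<in> parcs D}"

text \<open>The transpose of the directed rigidity matrix times the rigidity matrix, applied to \<open>x\<close> (the operator \<open>L\<close> of the
  introduction).\<close>

definition tail_operator ::
    "'v pair_pre_digraph \<Rightarrow> ('v \<Rightarrow> real ^ 'd::finite) \<Rightarrow> ('v \<Rightarrow> real ^ 'd) \<Rightarrow> 'v \<Rightarrow> real ^ 'd" where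
  "tail_operator D p x v = (\<Sum>w\<in>out_nbrs D v. strain p x (v, w) *\<^sub>R (p v - p w))"

lemma tail_operator_lincomb:
  "tail_operator D p (\<lambda>v. \<Sum>i\<in>I. c i *\<^sub>R x i v) = (\<lambda>v. \<Sum>i\<in>I. c i *\<^sub>R tail_operator D p (x i) v)"
  by (simp add: fun_eq_iff tail_operator_def strain_lincomb scaleR_sum_left scaleR_sum_right sum.swap[of _ I])

lemma tail_operator_diff:
  "tail_operator D p (\<lambda>v. x v - y v) v = tail_operator D p x v - tail_operator D p y v"
  by (simp add: tail_operator_def strain_diff scaleR_diff_left sum_subtractf)

context pair_digraph
begin

lemma finite_out_nbrs: "finite (out_nbrs G v)"
proof -
  have "out_nbrs G v \<subseteq> pverts G" by (auto simp: out_nbrs_def dest: in_arcsD2)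
  then show ?thesis using pair_finite_verts finite_subset by blast
qed

lemma sum_rigidity_matrix_arc:
  assumes "e \<in> parcs G"
  shows "(\<Sum>v\<in>pverts G. rigidity_matrix p e v \<bullet> x v) = strain p x e"
  using sum_rigidity_matrix[OF pair_finite_verts, of "fst e" "snd e" p x] assms
  by (simp add: arc_fst_in_verts arc_snd_in_verts)

lemma rigidity_image_eq:
  "rigidity_image G p = range (\<lambda>x. restrict (strain p x) (parcs G))"
proof -
  have "restrict (\<lambda>e. \<Sum>v\<in>pverts G. rigidity_matrix p e v \<bullet> x v) (parcs G) = restrict (strain p x) (parcs G)" for x
    by (intro restrict_ext sum_rigidity_matrix_arc)
  then show ?thesis unfolding rigidity_image_def by simp
qed

lemma edge_operator_strain:
  "edge_operator G p (restrict (strain p x) (parcs G))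
    = restrict (\<lambda>e. 2 * strain p (tail_operator G p x) e) (parcs G)"
proof -
  have tail: "(\<Sum>f\<in>parcs G. strain p x f *\<^sub>R directed_rigidity_matrix p f v) = tail_operator G p x v" for v
  proof -
    have "(\<Sum>f\<in>parcs G. strain p x f *\<^sub>R directed_rigidity_matrix p f v)
        = (\<Sum>f\<in>Pair v ` out_nbrs G v. strain p x f *\<^sub>R directed_rigidity_matrix p f v)"
      by (rule sum.mono_neutral_right)
        (auto simp: pair_finite_arcs out_nbrs_def directed_rigidity_matrix_def split: if_splits)
    also have "\<dots> = (\<Sum>w\<in>out_nbrs G v. strain p x (v, w) *\<^sub>R directed_rigidity_matrix p (v, w) v)"
      by (subst sum.reindex) (auto simp: inj_on_def)
    also have "\<dots> = tail_operator G p x v"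
      by (simp add: tail_operator_def directed_rigidity_matrix_def)
    finally show ?thesis .
  qed
  have "(\<Sum>f\<in>parcs G. edge_matrix G p e f * restrict (strain p x) (parcs G) f)
      = 2 * strain p (tail_operator G p x) e" if e: "e \<in> parcs G" for e
  proof -
    have "(\<Sum>f\<in>parcs G. edge_matrix G p e f * restrict (strain p x) (parcs G) f)
        = 2 * (\<Sum>f\<in>parcs G. \<Sum>v\<in>pverts G. rigidity_matrix p e v \<bullet> (strain p x f *\<^sub>R directed_rigidity_matrix p f v))"
      by (simp add: edge_matrix_def sum_distrib_left sum_distrib_right mult_ac)
    also have "\<dots> = 2 * (\<Sum>v\<in>pverts G. rigidity_matrix p e v \<bullet> tail_operator G p x v)"
      by (subst sum.swap) (simp only: inner_sum_right[symmetric] tail)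
    also have "\<dots> = 2 * strain p (tail_operator G p x) e"
      using e by (simp add: sum_rigidity_matrix_arc)
    finally show ?thesis .
  qed
  then show ?thesis unfolding edge_operator_def by (auto simp: restrict_def fun_eq_iff)
qed

end

text \<open>Each equation eliminates one unknown. The lemma serves as a dimension count for the image of the
  rigidity matrix, whose elements are functions on the arc set.\<close>

lemma homogeneous_system_nontrivial_solution:
  fixes a :: "'i \<Rightarrow> 'e \<Rightarrow> 'k::field"
  assumes "finite E" and "finite I" and "card E < card I"
  shows "\<exists>c. (\<exists>i\<in>I. c i \<noteq> 0) \<and> (\<forall>e\<in>E. (\<Sum>i\<in>I. c i * a i e) = 0)"
  using assms
proof (induction E arbitrary: I a rule: finite_induct)
  case empty
  then have "I \<noteq> {}" by auto
  then show ?case by (intro exI[of _ "\<lambda>_. 1"]) auto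
next
  case (insert e E)
  show ?case
  proof (cases "\<forall>i\<in>I. a i e = 0")
    case True
    have "\<exists>c. (\<exists>i\<in>I. c i \<noteq> 0) \<and> (\<forall>e\<in>E. (\<Sum>i\<in>I. c i * a i e) = 0)"
      using insert.prems insert.hyps by (intro insert.IH) auto
    then show ?thesis using True by auto
  next
    case False
    then obtain j where j: "j \<in> I" "a j e \<noteq> 0" by blast
    have "\<exists>c. (\<exists>i\<in>I - {j}. c i \<noteq> 0) \<and> (\<forall>f\<in>E. (\<Sum>i\<in>I - {j}. c i * (a i f - a i e / a j e * a j f)) = 0)"
      using insert.prems insert.hyps j by (intro insert.IH) auto
    then obtain c where c: "\<exists>i\<in>I - {j}. c i \<noteq> 0"
      and c0: "\<And>f. f \<in> E \<Longrightarrow> (\<Sum>i\<in>I - {j}. c i * (a i f - a i e / a j e * a j f)) = 0" by blast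
    define c' where "c' i = (if i = j then - (\<Sum>i\<in>I - {j}. c i * (a i e / a j e)) else c i)" for i
    have "(\<Sum>i\<in>I. c' i * a i f) = (\<Sum>i\<in>I - {j}. c i * (a i f - a i e / a j e * a j f))" for f
    proof -
      have "(\<Sum>i\<in>I. c' i * a i f) = c' j * a j f + (\<Sum>i\<in>I - {j}. c' i * a i f)"
        using insert.prems(1) j(1) by (rule sum.remove)
      also have "(\<Sum>i\<in>I - {j}. c' i * a i f) = (\<Sum>i\<in>I - {j}. c i * a i f)"
        by (intro sum.cong) (auto simp: c'_def)
      also have "c' j * a j f = - (\<Sum>i\<in>I - {j}. c i * (a i e / a j e * a j f))"
        by (simp add: c'_def sum_distrib_right mult.assoc)
      finally show ?thesis by (simp add: right_diff_distrib sum_subtractf)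
    qed
    moreover have "\<exists>i\<in>I. c' i \<noteq> 0" using c by (auto simp: c'_def)
    ultimately show ?thesis using c0 j(2) by (intro exI[of _ c']) auto
  qed
qed

text \<open>The operator induced by \<open>L\<close> on \<open>R W\<close> is injective, and \<open>R W\<close> is finite-dimensional because \<open>E\<close> is finite, although
  \<open>W\<close> itself may be infinite-dimensional. In a linear relation among the images of the iterates \<open>L\<^sup>i x\<close>,
  injectivity cancels powers of \<open>L\<close> until the coefficient of \<open>x\<close> is nonzero; solving for \<open>R x\<close> yields a preimage.\<close>

lemma injective_on_image_imp_surjective:
  fixes L :: "('v \<Rightarrow> 'a::real_vector) \<Rightarrow> 'v \<Rightarrow> 'a" and R :: "('v \<Rightarrow> 'a) \<Rightarrow> 'e \<Rightarrow> real"
  assumes E: "finite E"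
    and R: "\<And>n c x e. R (\<lambda>v. \<Sum>i<(n::nat). c i *\<^sub>R x i v) e = (\<Sum>i<n. c i * R (x i) e)"
    and L: "\<And>n c x. L (\<lambda>v. \<Sum>i<(n::nat). c i *\<^sub>R x i v) = (\<lambda>v. \<Sum>i<n. c i *\<^sub>R L (x i) v)"
    and W: "\<And>n c x. (\<And>i. x i \<in> W) \<Longrightarrow> (\<lambda>v. \<Sum>i<(n::nat). c i *\<^sub>R x i v) \<in> W"
    and LW: "\<And>x. x \<in> W \<Longrightarrow> L x \<in> W"
    and inj: "\<And>x. x \<in> W \<Longrightarrow> \<forall>e\<in>E. R (L x) e = 0 \<Longrightarrow> \<forall>e\<in>E. R x e = 0"
    and x: "x \<in> W"
  shows "\<exists>w\<in>W. \<forall>e\<in>E. R (L w) e = R x e"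
proof -
  have pow: "(L ^^ i) x \<in> W" for i
    by (induction i) (auto intro: x LW)
  have *: ?thesis if "\<exists>i<n. c i \<noteq> 0" "\<forall>e\<in>E. (\<Sum>i<n. c i * R ((L ^^ i) x) e) = 0" for n and c :: "nat \<Rightarrow> real"
    using that
  proof (induction n arbitrary: c)
    case (Suc n)
    have shift: "c 0 * R x e + (\<Sum>i<n. c (Suc i) * R (L ((L ^^ i) x)) e) = 0" if "e \<in> E" for e
      using Suc.prems(2) that by (simp only: sum.lessThan_Suc_shift) simp
    show ?case
    proof (cases "c 0 = 0")
      case True
      define y where "y = (\<lambda>v. \<Sum>i<n. c (Suc i) *\<^sub>R (L ^^ i) x v)"
      have "y \<in> W" unfolding y_def by (intro W pow)
      moreover have "\<forall>e\<in>E. R (L y) e = 0"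
        using shift True by (simp add: y_def L R)
      ultimately have "\<forall>e\<in>E. R y e = 0" by (rule inj)
      moreover have "\<exists>i<n. c (Suc i) \<noteq> 0"
        using Suc.prems(1) True by (metis Suc_less_eq not0_implies_Suc)
      ultimately show ?thesis by (intro Suc.IH[of "\<lambda>i. c (Suc i)"]) (simp_all add: y_def R)
    next
      case False
      define w where "w = (\<lambda>v. \<Sum>i<n. (- c (Suc i) / c 0) *\<^sub>R (L ^^ i) x v)"
      have "R (L w) e = R x e" if "e \<in> E" for e
      proof -
        have "R (L w) e = (\<Sum>i<n. (- c (Suc i) / c 0) * R (L ((L ^^ i) x)) e)"
          by (simp only: w_def L R)
        then have "c 0 * R (L w) e = - (\<Sum>i<n. c (Suc i) * R (L ((L ^^ i) x)) e)"
          using False by (simp add: sum_distrib_left sum_negf)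
        also have "\<dots> = c 0 * R x e" using shift[OF that] by simp
        finally show ?thesis using False by simp
      qed
      moreover have "w \<in> W" unfolding w_def by (intro W pow)
      ultimately show ?thesis by blast
    qed
  qed auto
  obtain c where "\<exists>i\<in>{..<Suc (card E)}. c i \<noteq> 0"
    "\<forall>e\<in>E. (\<Sum>i<Suc (card E). c i * R ((L ^^ i) x) e) = 0"
    using homogeneous_system_nontrivial_solution[OF E, of "{..<Suc (card E)}" "\<lambda>i. R ((L ^^ i) x)"] by auto
  then show ?thesis by (intro *) auto
qed

context pair_digraph
begin

text \<open>By induction along the arcs: if \<open>y = L x\<close> vanishes at the out-neighbours of \<open>v\<close>, then \<open>y v\<close> is orthogonal to the
  vectors \<open>p v - p w\<close> of the arcs leaving \<open>v\<close>. But \<open>y v\<close> is a combination of these same vectors.\<close>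

lemma tail_operator_eq_zero:
  fixes f :: "'a \<Rightarrow> nat"
  assumes f: "\<And>v w. (v, w) \<in> parcs G \<Longrightarrow> f w < f v"
    and 0: "\<And>e. e \<in> parcs G \<Longrightarrow> strain p (tail_operator G p x) e = 0"
  shows "tail_operator G p x v = 0"
proof (induction v rule: measure_induct_rule[of f])
  case (less v)
  let ?y = "tail_operator G p x"
  have "(p v - p w) \<bullet> ?y v = 0" if "w \<in> out_nbrs G v" for w
  proof -
    have "(v, w) \<in> parcs G" using that by (simp add: out_nbrs_def)
    then have "strain p ?y (v, w) = 0" "?y w = 0" using 0 f less.IH by auto
    then show ?thesis by (simp add: strain_def)
  qed
  then have "(\<Sum>w\<in>out_nbrs G v. strain p x (v, w) *\<^sub>R (p v - p w)) \<bullet> ?y v = 0"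
    by (simp add: inner_sum_left)
  then have "?y v \<bullet> ?y v = 0" by (simp add: tail_operator_def)
  then show ?case by simp
qed

text \<open>The field with the value \<open>\<xi>\<close> at \<open>k\<close> and zero elsewhere is mapped by \<open>L\<close> into the space \<open>W\<close> of fields that vanish up
  to \<open>k\<close>. This space is invariant under \<open>L\<close>, so the induced operator is surjective on its image, and a field of
  \<open>W\<close> can be subtracted to obtain a kernel element without disturbing the values up to \<open>k\<close>. The existence of a kernel
  element of \<open>L\<close> with a given leading part in the kernel of a diagonal block is what rules out Jordan blocks of \<open>L\<close> at zero.\<close>

lemma flex_extending_local_flex:
  fixes f :: "'a \<Rightarrow> nat"
  assumes f: "\<And>v w. (v, w) \<in> parcs G \<Longrightarrow> f w < f v"
    and inj: "\<And>x. \<forall>e\<in>parcs G. strain p (tail_operator G p x) e = 0 \<Longrightarrow> \<forall>e\<in>parcs G. strain p x e = 0"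
    and \<xi>: "\<And>w. w \<in> out_nbrs G k \<Longrightarrow> (p k - p w) \<bullet> \<xi> = 0"
  shows "\<exists>u. (\<forall>v. f v < f k \<longrightarrow> u v = 0) \<and> u k = \<xi> \<and> (\<forall>e\<in>parcs G. strain p u e = 0)"
proof -
  define W where "W = {x :: 'a \<Rightarrow> real ^ 'b. \<forall>v. f v \<le> f k \<longrightarrow> x v = 0}"
  have out: "f w < f v" if "w \<in> out_nbrs G v" for v w
    using f that by (simp add: out_nbrs_def)
  define u where "u v = (if v = k then \<xi> else 0)" for v
  have "strain p u (v, w) = 0" if "f v \<le> f k" "w \<in> out_nbrs G v" for v w
    using \<xi> out[OF that(2)] that by (auto simp: strain_def u_def)
  then have Tu: "tail_operator G p u \<in> W" by (simp add: W_def tail_operator_def)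
  have TW: "tail_operator G p x \<in> W" if "x \<in> W" for x
  proof -
    have "strain p x (v, w) = 0" if "f v \<le> f k" "w \<in> out_nbrs G v" for v w
      using \<open>x \<in> W\<close> out[OF that(2)] that by (auto simp: strain_def W_def)
    then show ?thesis by (simp add: W_def tail_operator_def)
  qed
  have "\<exists>w\<in>W. \<forall>e\<in>parcs G. strain p (tail_operator G p w) e = strain p (tail_operator G p u) e"
  proof (rule injective_on_image_imp_surjective[where L = "tail_operator G p" and R = "strain p",
        OF pair_finite_arcs strain_lincomb tail_operator_lincomb _ TW _ Tu])
    show "(\<lambda>v. \<Sum>i<n. c i *\<^sub>R x i v) \<in> W" if "\<And>i. x i \<in> W" for n :: nat and c x
      using that by (simp add: W_def)
    show "\<forall>e\<in>parcs G. strain p x e = 0"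
      if "\<forall>e\<in>parcs G. strain p (tail_operator G p x) e = 0" for x
      using that by (rule inj)
  qed
  then obtain w where w: "w \<in> W" "\<forall>e\<in>parcs G. strain p (tail_operator G p w) e = strain p (tail_operator G p u) e"
    by blast
  have "\<forall>e\<in>parcs G. strain p (tail_operator G p (\<lambda>v. u v - w v)) e = 0"
    using w(2) by (simp add: tail_operator_diff[abs_def] strain_diff)
  from inj[OF this] w(1) show ?thesis
    by (intro exI[of _ "\<lambda>v. u v - w v"]) (auto simp: W_def u_def)
qed

lemma bij_betw_edge_operator_iff:
  "bij_betw (edge_operator G p) (rigidity_image G p) (rigidity_image G p) \<longleftrightarrow>
    (\<forall>x. (\<forall>e\<in>parcs G. strain p (tail_operator G p x) e = 0) \<longrightarrow> (\<forall>e\<in>parcs G. strain p x e = 0))"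
  (is "?bij \<longleftrightarrow> ?inj")
proof
  assume ?bij
  then have inj: "inj_on (edge_operator G p) (rigidity_image G p)" by (simp add: bij_betw_def)
  show ?inj
  proof (intro allI impI)
    fix x assume x: "\<forall>e\<in>parcs G. strain p (tail_operator G p x) e = 0"
    let ?R = "\<lambda>x. restrict (strain p x) (parcs G)"
    have z: "strain p (\<lambda>v. 0) e = 0" "tail_operator G p (\<lambda>v. 0) = (\<lambda>v. 0)" for e
      by (cases e) (auto simp: strain_def tail_operator_def)
    have "edge_operator G p (?R x) = edge_operator G p (?R (\<lambda>v. 0))"
      unfolding edge_operator_strain by (intro restrict_ext) (simp add: x z)
    then have eq: "?R x = ?R (\<lambda>v. 0)"
      by (rule inj_onD[OF inj]) (simp_all add: rigidity_image_eq)
    then have "strain p x e = 0" if "e \<in> parcs G" for e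
    proof -
      have "?R x e = ?R (\<lambda>v. 0) e" by (simp only: eq)
      with that show ?thesis by (simp only: restrict_apply' z(1))
    qed
    then show "\<forall>e\<in>parcs G. strain p x e = 0" by blast
  qed
next
  assume inj: ?inj
  let ?R = "\<lambda>x. restrict (strain p x) (parcs G)"
  have twice: "edge_operator G p (?R x) = ?R (\<lambda>v. 2 *\<^sub>R tail_operator G p x v)" for x
    unfolding edge_operator_strain
    by (intro restrict_ext) (simp add: strain_def case_prod_unfold flip: scaleR_diff_right)
  show ?bij
  proof (rule bij_betwI')
    fix y z assume "y \<in> rigidity_image G p" "z \<in> rigidity_image G p"
    then obtain a b where ab: "y = ?R a" "z = ?R b" by (auto simp: rigidity_image_eq)
    show "edge_operator G p y = edge_operator G p z \<longleftrightarrow> y = z"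
    proof
      assume eq: "edge_operator G p y = edge_operator G p z"
      have "strain p (tail_operator G p a) e = strain p (tail_operator G p b) e" if "e \<in> parcs G" for e
      proof -
        have "edge_operator G p (?R a) e = edge_operator G p (?R b) e" using eq by (simp only: ab)
        with that show ?thesis by (simp add: edge_operator_strain)
      qed
      then have "\<forall>e\<in>parcs G. strain p (tail_operator G p (\<lambda>v. a v - b v)) e = 0"
        by (simp add: tail_operator_diff[abs_def] strain_diff)
      then have "\<forall>e\<in>parcs G. strain p (\<lambda>v. a v - b v) e = 0" using inj by blast
      then show "y = z" unfolding ab by (intro restrict_ext) (simp add: strain_diff)
    qed simp
  next
    fix y assume "y \<in> rigidity_image G p"
    then show "edge_operator G p y \<in> rigidity_image G p"
      by (auto simp: rigidity_image_eq twice)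
  next
    fix y assume "y \<in> rigidity_image G p"
    then obtain a where a: "y = ?R a" by (auto simp: rigidity_image_eq)
    have "\<exists>w\<in>UNIV. \<forall>e\<in>parcs G. strain p (tail_operator G p w) e = strain p a e"
      using inj
      by (intro injective_on_image_imp_surjective[where L = "tail_operator G p" and R = "strain p",
        OF pair_finite_arcs strain_lincomb tail_operator_lincomb]) simp_all
    then obtain w where w: "\<And>e. e \<in> parcs G \<Longrightarrow> strain p (tail_operator G p w) e = strain p a e" by blast
    have half: "strain p (tail_operator G p (\<lambda>v. (1 / 2) *\<^sub>R w v)) e = strain p (tail_operator G p w) e / 2" for e
      using tail_operator_lincomb[of G p "\<lambda>_. 1 / 2" "\<lambda>_. w" "{()}"]
        strain_lincomb[of p "\<lambda>_. 1 / 2" "\<lambda>_. tail_operator G p w" "{()}"] by simp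
    have "y = edge_operator G p (?R (\<lambda>v. (1 / 2) *\<^sub>R w v))"
      unfolding a edge_operator_strain by (intro restrict_ext) (simp add: half w)
    then show "\<exists>x\<in>rigidity_image G p. y = edge_operator G p x"
      by (auto simp: rigidity_image_eq)
  qed
qed

end

section \<open>Tight rankings and admissibility\<close>

lemma acyclic_imp_ranking:
  assumes "finite V" and "acyclic r"
  shows "\<exists>f :: 'v \<Rightarrow> nat. bij_betw f V {..<card V} \<and> (\<forall>v\<in>V. \<forall>w\<in>V. (v, w) \<in> r \<longrightarrow> f w < f v)"
  using assms(1)
proof (induction "card V" arbitrary: V)
  case 0
  then show ?case by (intro exI[of _ "\<lambda>_. 0"]) (simp add: bij_betw_def)
next
  case (Suc n)
  let ?r = "r \<inter> V \<times> V"
  have "wf ?r"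
    using Suc.prems assms(2) by (intro finite_acyclic_wf) (auto intro: acyclic_subset)
  moreover have "V \<noteq> {}" using Suc.hyps(2) by auto
  ultimately obtain z where z: "z \<in> V" and z_min: "\<And>y. (y, z) \<in> ?r \<Longrightarrow> y \<notin> V"
    using wfE_min'[of ?r V] by blast
  have card: "card (V - {z}) = n" using Suc.hyps(2) Suc.prems z by simp
  obtain f :: "'v \<Rightarrow> nat" where f: "bij_betw f (V - {z}) {..<n}"
    and f_r: "\<And>v w. v \<in> V - {z} \<Longrightarrow> w \<in> V - {z} \<Longrightarrow> (v, w) \<in> r \<Longrightarrow> f w < f v"
    using Suc.hyps(1)[of "V - {z}"] card Suc.prems by auto
  \<comment> \<open>No arc enters \<open>z\<close>, so \<open>z\<close> may come last.\<close>
  define g where "g = f(z := n)"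
  have "bij_betw g (V - {z}) {..<n}"
    using f by (rule bij_betw_cong[THEN iffD1, rotated]) (simp add: g_def)
  then have "bij_betw g ((V - {z}) \<union> {z}) ({..<n} \<union> {n})"
    by (intro bij_betw_combine) (auto simp: g_def bij_betw_def)
  moreover have "(V - {z}) \<union> {z} = V" "{..<n} \<union> {n} = {..<card V}"
    using z Suc.hyps(2) by auto
  ultimately have "bij_betw g V {..<card V}" by simp
  moreover have "g w < g v" if "v \<in> V" "w \<in> V" "(v, w) \<in> r" for v w
  proof -
    have "w \<noteq> z" using z_min[of v] that z by blast
    then have "f w < n" using f that(2) by (auto simp: bij_betw_def)
    then show ?thesis using f_r that \<open>w \<noteq> z\<close> by (auto simp: g_def)
  qed
  ultimately show ?case by blast
qed

lemma sum_lessThan_diff: "(\<Sum>i<d. d - i) = (d + 1 :: nat) choose 2"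
proof (induction d)
  case (Suc d)
  have "(\<Sum>i<Suc d. Suc d - i) = Suc d + (\<Sum>i<d. d - i)"
    by (simp only: sum.lessThan_Suc_shift) simp
  then show ?case using Suc by (simp add: numeral_2_eq_2)
qed (simp add: numeral_2_eq_2)

definition ranking :: "'v pair_pre_digraph \<Rightarrow> ('v \<Rightarrow> nat) \<Rightarrow> bool" where
  "ranking D f \<longleftrightarrow> bij_betw f (pverts D) {..<card (pverts D)} \<and> (\<forall>(v, w)\<in>parcs D. f w < f v)"

text \<open>The out-degree of \<open>v\<close> is at most \<open>f v\<close>, so \<open>d - f v\<close> (truncated) is the least defect that \<open>v\<close> can have; tightness
  says that every vertex attains it.\<close>

definition tight :: "'d::finite itself \<Rightarrow> 'v pair_pre_digraph \<Rightarrow> ('v \<Rightarrow> nat) \<Rightarrow> bool" where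
  "tight d D f \<longleftrightarrow> (\<forall>v\<in>pverts D. CARD('d) - card (out_nbrs D v) = CARD('d) - f v)"

lemma out_degree_eq: "out_degree (with_proj D) v = card (out_nbrs D v)"
proof -
  have "out_arcs (with_proj D) v = Pair v ` out_nbrs D v"
    by (auto simp: out_arcs_def out_nbrs_def)
  then show ?thesis by (simp add: out_degree_def card_image inj_on_def)
qed

context pair_digraph
begin

lemma ranking_initial_segment:
  assumes f: "ranking G f" and m: "m \<le> card (pverts G)"
  shows "bij_betw f {w \<in> pverts G. f w < m} {..<m}"
proof -
  have bij: "bij_betw f (pverts G) {..<card (pverts G)}" using f by (simp add: ranking_def)
  have "f ` {w \<in> pverts G. f w < m} = {..<m}"
  proof (intro equalityI subsetI)
    fix i assume i: "i \<in> {..<m}"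
    then have "i \<in> f ` pverts G" using bij m by (auto simp: bij_betw_def)
    then show "i \<in> f ` {w \<in> pverts G. f w < m}" using i by auto
  qed auto
  moreover have "inj_on f {w \<in> pverts G. f w < m}"
    using bij by (auto simp: bij_betw_def intro: inj_on_subset)
  ultimately show ?thesis by (simp add: bij_betw_def)
qed

lemma card_initial_segment:
  assumes "ranking G f" and "m \<le> card (pverts G)"
  shows "card {w \<in> pverts G. f w < m} = m"
  using bij_betw_same_card[OF ranking_initial_segment[OF assms]] by simp

lemma card_earlier:
  assumes f: "ranking G f" and v: "v \<in> pverts G"
  shows "card {w \<in> pverts G. f w < f v} = f v"
proof (rule card_initial_segment[OF f])
  have "f v \<in> {..<card (pverts G)}" using f v by (auto simp: ranking_def bij_betw_def)
  then show "f v \<le> card (pverts G)" by simp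
qed

lemma out_nbrs_earlier:
  assumes f: "ranking G f"
  shows "out_nbrs G v \<subseteq> {w \<in> pverts G. f w < f v}"
  using f by (auto simp: ranking_def out_nbrs_def dest: in_arcsD2)

lemma card_out_nbrs_le:
  assumes f: "ranking G f" and v: "v \<in> pverts G"
  shows "card (out_nbrs G v) \<le> f v"
  using card_mono[OF _ out_nbrs_earlier[OF f, of v]] card_earlier[OF f v] pair_finite_verts by simp

lemma defect_eq_iff_tight:
  assumes f: "ranking G f" and n: "CARD('d::finite) \<le> card (pverts G)"
  shows "defect TYPE('d) G = (CARD('d) + 1) choose 2 \<longleftrightarrow> tight TYPE('d) G f"
proof -
  let ?d = "CARD('d)"
  have "(\<Sum>v\<in>pverts G. ?d - f v) = (\<Sum>i<card (pverts G). ?d - i)"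
    using f by (intro sum.reindex_bij_betw) (simp add: ranking_def)
  also have "\<dots> = (\<Sum>i<?d. ?d - i)"
    using n by (intro sum.mono_neutral_right) auto
  finally have total: "(\<Sum>v\<in>pverts G. ?d - f v) = (?d + 1) choose 2"
    by (simp only: sum_lessThan_diff)
  have le: "?d - f v \<le> ?d - card (out_nbrs G v)" if "v \<in> pverts G" for v
    using card_out_nbrs_le[OF f that] by simp
  have defect: "defect TYPE('d) G = (\<Sum>v\<in>pverts G. ?d - card (out_nbrs G v))"
    by (simp add: defect_def vertex_defect_def out_degree_eq)
  show ?thesis
  proof
    assume "defect TYPE('d) G = (?d + 1) choose 2"
    then have "(\<Sum>v\<in>pverts G. ?d - f v) = (\<Sum>v\<in>pverts G. ?d - card (out_nbrs G v))"
      by (simp only: defect total)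
    from sum_mono_inv[OF this le _ pair_finite_verts] show "tight TYPE('d) G f"
      unfolding tight_def by simp
  next
    assume "tight TYPE('d) G f"
    then show "defect TYPE('d) G = (?d + 1) choose 2"
      unfolding defect total[symmetric] by (intro sum.cong) (simp_all add: tight_def)
  qed
qed

end

context pair_digraph
begin

lemma tight_imp_out_nbrs_eq:
  assumes f: "ranking G f" and tight: "tight TYPE('d::finite) G f"
    and v: "v \<in> pverts G" "f v < CARD('d)"
  shows "out_nbrs G v = {w \<in> pverts G. f w < f v}"
proof -
  have "CARD('d) - card (out_nbrs G v) = CARD('d) - f v"
    using tight v(1) by (simp add: tight_def)
  then have "card (out_nbrs G v) = f v" using v(2) by linarith
  then show ?thesis
    using card_earlier[OF f v(1)] pair_finite_verts
    by (intro card_subset_eq out_nbrs_earlier[OF f]) auto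
qed

text \<open>The set \<open>U\<close> of the first \<open>d\<close> vertices carries a complete graph, on which \<open>L x = 0\<close> gives vanishing strain
  arc by arc, since at most \<open>d\<close> arcs leave each of its vertices and their vectors are independent. After subtraction of
  the infinitesimal isometry \<open>t\<close> that extends \<open>x\<close> from \<open>U\<close>, each further vertex \<open>v\<close> is treated by pairing
  \<open>L (x - t)\<close> with \<open>x - t\<close> at \<open>v\<close>: a sum of squares vanishes, and the vectors of the arcs leaving \<open>v\<close> span.\<close>

lemma tight_imp_injective:
  fixes p :: "'a \<Rightarrow> real ^ 'd::finite"
  assumes f: "ranking G f" and n: "CARD('d) \<le> card (pverts G)" and tight: "tight TYPE('d) G f"
    and p: "generic_position (pverts G) p"
    and x: "\<forall>e\<in>parcs G. strain p (tail_operator G p x) e = 0"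
  shows "\<forall>e\<in>parcs G. strain p x e = 0"
proof -
  let ?V = "pverts G"
  define U where "U = {v \<in> ?V. f v < CARD('d)}"
  have bij: "bij_betw f ?V {..<card ?V}" and f_arc: "\<And>v w. (v, w) \<in> parcs G \<Longrightarrow> f w < f v"
    using f by (auto simp: ranking_def)
  have Tx: "tail_operator G p x v = 0" for v
    using tail_operator_eq_zero[of f, OF f_arc] x by blast
  have out: "out_nbrs G v \<subseteq> ?V - {v}" for v
    using out_nbrs_earlier[OF f, of v] by auto
  have interpol: "\<exists>y. \<forall>j\<in>J. (p v - p j) \<bullet> y = \<beta> j" if "v \<in> ?V" "J \<subseteq> ?V - {v}" "card J \<le> CARD('d)" for v J \<beta>
    using that by (rule generic_positionD[OF p])
  have arc0: "strain p x (v, w) = 0" if v: "v \<in> U" and w: "w \<in> U" and wv: "f w < f v" for v w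
  proof -
    have vV: "v \<in> ?V" "f v < CARD('d)" using v by (auto simp: U_def)
    have out_v: "out_nbrs G v = {w \<in> ?V. f w < f v}"
      by (rule tight_imp_out_nbrs_eq[OF f tight vV])
    then have c: "card (out_nbrs G v) = f v" using card_earlier[OF f vV(1)] by simp
    from out_v have "w \<in> out_nbrs G v" using w wv by (simp add: U_def)
    moreover have "(\<Sum>w\<in>out_nbrs G v. strain p x (v, w) *\<^sub>R (p v - p w)) = 0"
      using Tx[of v] by (simp add: tail_operator_def)
    ultimately show ?thesis
      using interpolation_imp_lin_indep[of "out_nbrs G v" "\<lambda>w. p v - p w" "\<lambda>w. strain p x (v, w)" w]
        interpol[OF vV(1) out] c vV(2) finite_out_nbrs by simp
  qed
  have f_inj: "f v = f w \<Longrightarrow> v = w" if "v \<in> ?V" "w \<in> ?V" for v w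
    using bij that by (auto simp: bij_betw_def inj_on_def)
  have U0: "strain p x (v, w) = 0" if "v \<in> U" "w \<in> U" for v w
  proof (cases "f v" "f w" rule: linorder_cases)
    case equal
    then have "v = w" using f_inj that by (simp add: U_def)
    then show ?thesis by (simp add: strain_def)
  qed (use arc0 that strain_sym in metis)+
  have cU: "card U = CARD('d)" unfolding U_def by (rule card_initial_segment[OF f n])
  have U: "U \<subseteq> ?V" "card U \<le> CARD('d)" "finite U"
    using pair_finite_verts cU by (auto simp: U_def)
  have "U \<noteq> {}" using cU by (metis card.empty less_irrefl zero_less_card_finite)
  obtain t where t: "\<And>v. v \<in> U \<Longrightarrow> t v = x v" and t0: "\<And>i j. strain p t (i, j) = 0"
    using infinitesimal_isometry_extends[OF p U(1) \<open>U \<noteq> {}\<close> U(2,3) U0] by blast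
  have xt: "x v = t v" if "v \<in> ?V" for v
    using that
  proof (induction v rule: measure_induct_rule[of f])
    case (less v)
    show ?case
    proof (cases "v \<in> U")
      case False
      then have "CARD('d) \<le> card (out_nbrs G v)"
        using tight less.prems by (fastforce simp: tight_def U_def)
      then obtain J where J: "J \<subseteq> out_nbrs G v" "card J = CARD('d)"
        by (meson obtain_subset_with_card_n)
      let ?y = "x v - t v"
      have s: "strain p x (v, w) = (p v - p w) \<bullet> ?y" if w: "w \<in> out_nbrs G v" for w
      proof -
        have "w \<in> ?V" using out w by blast
        moreover have "f w < f v" using f_arc w by (simp add: out_nbrs_def)
        ultimately have "x w = t w" using less.IH by blast
        then have "strain p x (v, w) - strain p t (v, w) = (p v - p w) \<bullet> ?y"
          by (simp add: strain_def inner_diff_right)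
        then show ?thesis by (simp add: t0)
      qed
      have "0 = tail_operator G p x v \<bullet> ?y" by (simp add: Tx)
      also have "\<dots> = (\<Sum>w\<in>out_nbrs G v. ((p v - p w) \<bullet> ?y)\<^sup>2)"
        by (simp add: tail_operator_def inner_sum_left s power2_eq_square)
      finally have "\<forall>w\<in>out_nbrs G v. ((p v - p w) \<bullet> ?y)\<^sup>2 = 0"
        using sum_nonneg_eq_0_iff[of "out_nbrs G v" "\<lambda>w. ((p v - p w) \<bullet> ?y)\<^sup>2"] finite_out_nbrs by simp
      then have "?y = 0"
        using interpolation_imp_orthogonal_zero[of J "\<lambda>w. p v - p w" ?y] J
          interpol[OF less.prems, of J] out by fastforce
      then show ?thesis by simp
    qed (simp add: t)
  qed
  have "strain p x e = strain p t e" if "e \<in> parcs G" for e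
    using xt[OF arc_fst_in_verts[OF that]] xt[OF arc_snd_in_verts[OF that]]
    by (cases e) (simp add: strain_def)
  then show ?thesis using t0 by auto
qed

text \<open>If \<open>k\<close> violates tightness, some earlier \<open>j\<close> is not an out-neighbour of \<open>k\<close>, and there is room for it: \<open>j\<close> and the
  out-neighbours together are at most \<open>d\<close> vertices. So a vector \<open>\<xi>\<close> can be orthogonal to all arcs leaving \<open>k\<close> but not to the
  pair \<open>kj\<close>, and the flex that extends \<open>\<xi>\<close> is not isometric.\<close>

lemma injective_imp_tight:
  fixes p :: "'a \<Rightarrow> real ^ 'd::finite"
  assumes f: "ranking G f" and p: "generic_position (pverts G) p"
    and rigid: "\<And>x i j. \<forall>e\<in>parcs G. strain p x e = 0 \<Longrightarrow> i \<in> pverts G \<Longrightarrow> j \<in> pverts G \<Longrightarrow> strain p x (i, j) = 0"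
    and inj: "\<And>x. \<forall>e\<in>parcs G. strain p (tail_operator G p x) e = 0 \<Longrightarrow> \<forall>e\<in>parcs G. strain p x e = 0"
  shows "tight TYPE('d) G f"
  unfolding tight_def
proof (intro ballI, rule ccontr)
  let ?V = "pverts G"
  fix k assume k: "k \<in> ?V" and neq: "CARD('d) - card (out_nbrs G k) \<noteq> CARD('d) - f k"
  have small: "card (out_nbrs G k) < CARD('d)" "card (out_nbrs G k) < f k"
    using neq card_out_nbrs_le[OF f k] by linarith+
  have "\<not> {w \<in> ?V. f w < f k} \<subseteq> out_nbrs G k"
    using card_mono[OF finite_out_nbrs, of "{w \<in> ?V. f w < f k}" k] card_earlier[OF f k] small(2) by auto
  then obtain j where j: "j \<in> ?V" "f j < f k" "j \<notin> out_nbrs G k" by blast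
  let ?J = "insert j (out_nbrs G k)"
  have "?J \<subseteq> ?V - {k}" using out_nbrs_earlier[OF f, of k] j by auto
  moreover have "card ?J \<le> CARD('d)" using small(1) j(3) finite_out_nbrs by simp
  ultimately have "\<exists>y. \<forall>w\<in>?J. (p k - p w) \<bullet> y = (if w = j then 1 else 0)"
    by (rule generic_positionD[OF p k])
  then obtain \<xi> where \<xi>: "\<And>w. w \<in> ?J \<Longrightarrow> (p k - p w) \<bullet> \<xi> = (if w = j then 1 else 0)" by blast
  have "\<exists>u. (\<forall>v. f v < f k \<longrightarrow> u v = 0) \<and> u k = \<xi> \<and> (\<forall>e\<in>parcs G. strain p u e = 0)"
  proof (rule flex_extending_local_flex)
    show "f w < f v" if "(v, w) \<in> parcs G" for v w using f that by (auto simp: ranking_def)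
    show "(p k - p w) \<bullet> \<xi> = 0" if "w \<in> out_nbrs G k" for w
      using \<xi>[of w] that j(3) by auto
  qed (rule inj)
  then obtain u where u: "\<And>v. f v < f k \<Longrightarrow> u v = 0" "u k = \<xi>" "\<forall>e\<in>parcs G. strain p u e = 0" by blast
  have "strain p u (k, j) = 0" using rigid[OF u(3)] k j(1) by simp
  then show False using \<xi>[of j] u(1)[OF j(2)] u(2) by (simp add: strain_def)
qed

theorem admissible_iff_tight:
  assumes rigid: "rigid TYPE('d::finite) (mk_symmetric (with_proj G))"
    and f: "ranking G f" and n: "CARD('d) \<le> card (pverts G)"
  shows "admissible TYPE('d) G \<longleftrightarrow> tight TYPE('d) G f"
proof
  let ?V = "pverts G"
  assume "tight TYPE('d) G f"
  then have "for_generic ?V (\<lambda>p :: 'a \<Rightarrow> real ^ 'd.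
      bij_betw (edge_operator G p) (rigidity_image G p) (rigidity_image G p))"
    using tight_imp_injective[OF f n]
    by (intro for_generic_mono[OF for_generic_generic_position[OF pair_finite_verts]])
      (simp add: bij_betw_edge_operator_iff)
  with rigid show "admissible TYPE('d) G" by (simp add: admissible_def)
next
  let ?V = "pverts G" and ?S = "mk_symmetric (with_proj G)"
  assume "admissible TYPE('d) G"
  then have bij: "for_generic ?V (\<lambda>p :: 'a \<Rightarrow> real ^ 'd.
      bij_betw (edge_operator G p) (rigidity_image G p) (rigidity_image G p))"
    by (simp add: admissible_def)
  have "for_generic (pverts ?S) (\<lambda>p :: 'a \<Rightarrow> real ^ 'd. \<forall>x. (\<forall>e\<in>parcs ?S. strain p x e = 0) \<longrightarrow>
      (\<forall>i\<in>pverts ?S. \<forall>j\<in>pverts ?S. strain p x (i, j) = 0))"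
    using rigid pair_finite_verts
    by (intro rigid_imp_generic_infinitesimally_rigid)
      (auto simp: parcs_mk_symmetric dest: in_arcsD1 in_arcsD2)
  then have inf_rigid: "for_generic ?V (\<lambda>p :: 'a \<Rightarrow> real ^ 'd. \<forall>x. (\<forall>e\<in>parcs ?S. strain p x e = 0) \<longrightarrow>
      (\<forall>i\<in>?V. \<forall>j\<in>?V. strain p x (i, j) = 0))"
    by simp
  obtain p :: "'a \<Rightarrow> real ^ 'd" where p: "generic_position ?V p \<and>
    bij_betw (edge_operator G p) (rigidity_image G p) (rigidity_image G p) \<and>
    (\<forall>x. (\<forall>e\<in>parcs ?S. strain p x e = 0) \<longrightarrow> (\<forall>i\<in>?V. \<forall>j\<in>?V. strain p x (i, j) = 0))"
    by (rule for_generic_obtain[OF for_generic_conj[OF for_generic_generic_position[OF pair_finite_verts]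
      for_generic_conj[OF bij inf_rigid]]])
  show "tight TYPE('d) G f"
  proof (rule injective_imp_tight[OF f conjunct1[OF p]])
    fix x i j assume x: "\<forall>e\<in>parcs G. strain p x e = 0" and ij: "i \<in> ?V" "j \<in> ?V"
    have "strain p x (a, b) = 0" if "(a, b) \<in> parcs ?S" for a b
    proof -
      have "(a, b) \<in> parcs G \<or> (b, a) \<in> parcs G" using that by (auto simp: parcs_mk_symmetric)
      then show ?thesis using x strain_sym[of p x a b] by auto
    qed
    then have "\<forall>e\<in>parcs ?S. strain p x e = 0" by auto
    with p have "\<forall>i\<in>?V. \<forall>j\<in>?V. strain p x (i, j) = 0" by (elim conjE allE[of _ x] impE)
    then show "strain p x (i, j) = 0" using ij by blast
  next
    fix x assume "\<forall>e\<in>parcs G. strain p (tail_operator G p x) e = 0"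
    then show "\<forall>e\<in>parcs G. strain p x e = 0"
      using p by (simp add: bij_betw_edge_operator_iff)
  qed
qed

end

section \<open>Root extensions\<close>

lemma acyclic_imp_ex_ranking:
  assumes "pair_digraph D" and "acyclic_digraph (with_proj D)"
  shows "\<exists>f. ranking D f"
proof -
  interpret pair_digraph D by fact
  have "acyclic (parcs D)" using assms(2) by (simp add: acyclic_digraph_def)
  from acyclic_imp_ranking[OF pair_finite_verts this] show ?thesis
    unfolding ranking_def using in_arcsD1 in_arcsD2 by blast
qed

lemma rigid_complete:
  assumes "\<And>i j. i \<in> pverts G \<Longrightarrow> j \<in> pverts G \<Longrightarrow> i \<noteq> j \<Longrightarrow> (i, j) \<in> parcs G"
  shows "rigid TYPE('d::finite) G"
  unfolding rigid_def
proof (rule for_generic_const, intro exI[of _ "1::real"] conjI ballI impI)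
  fix p q :: "'a \<Rightarrow> real ^ 'd"
  assume "(\<forall>v\<in>pverts G. dist (q v) (p v) < 1) \<and> distance_map G q = distance_map G p"
  then have eq: "distance_map G q = distance_map G p" by simp
  show "congruent_configs (pverts G) p q"
    unfolding congruent_configs_def
  proof (intro ballI)
    fix i j assume ij: "i \<in> pverts G" "j \<in> pverts G"
    show "norm (q j - q i) = norm (p j - p i)"
    proof (cases "i = j")
      case False
      then have "(norm (q j - q i))\<^sup>2 = (norm (p j - p i))\<^sup>2"
        using fun_cong[OF eq, of "(i, j)"] assms ij by (simp add: distance_map_def)
      then show ?thesis by simp
    qed simp
  qed
qed simp

lemma stable_root_extension_imp_subset:
  assumes "stable_root_extension d H D"
  shows "pverts H \<subseteq> pverts D"
  using assms by (auto simp: stable_root_extension_def root_extension_def induced_subgraph_def subgraph_def)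

text \<open>Arcs from \<open>H\<close> stay in \<open>H\<close>, so its vertices keep their out-degrees, and the new vertices have defect zero.\<close>

lemma defect_stable_root_extension:
  assumes ext: "stable_root_extension TYPE('d::finite) H D" and "finite (pverts D)"
  shows "defect TYPE('d) H = defect TYPE('d) D"
proof -
  have arcs: "parcs H = {e \<in> parcs D. fst e \<in> pverts H \<and> snd e \<in> pverts H}"
    and no_out: "\<And>u v. u \<in> pverts H \<Longrightarrow> v \<in> pverts D \<Longrightarrow> (u, v) \<in> parcs D \<Longrightarrow> v \<in> pverts H"
    and wf: "wf_digraph (with_proj D)"
    and deg: "\<And>v. v \<in> pverts D - pverts H \<Longrightarrow> vertex_defect TYPE('d) D v = 0"
    using ext by (auto simp: stable_root_extension_def root_extension_def induced_subgraph_def subgraph_def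
      vertex_defect_def)
  have sub: "pverts H \<subseteq> pverts D" using ext by (rule stable_root_extension_imp_subset)
  have "out_nbrs D v = out_nbrs H v" if "v \<in> pverts H" for v
    using that no_out wf_digraph.head_in_verts[OF wf] by (fastforce simp: out_nbrs_def arcs)
  then have "defect TYPE('d) H = (\<Sum>v\<in>pverts H. vertex_defect TYPE('d) D v)"
    by (simp add: defect_def vertex_defect_def out_degree_eq)
  also have "\<dots> = defect TYPE('d) D"
    unfolding defect_def using sub deg assms(2) by (intro sum.mono_neutral_left) auto
  finally show ?thesis .
qed

lemma defect_stable_root_extensions:
  assumes "(stable_root_extension TYPE('d::finite))\<^sup>*\<^sup>* H D" and "finite (pverts D)"
  shows "defect TYPE('d) H = defect TYPE('d) D"
  using assms
proof induction
  case (step D E)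
  have "finite (pverts D)"
    using stable_root_extension_imp_subset[OF step.hyps(2)] step.prems finite_subset by blast
  with step show ?case using defect_stable_root_extension by metis
qed simp

lemma complete_imp_tight:
  assumes "pair_digraph D" and f: "ranking D f"
    and complete: "\<And>i j. i \<in> pverts D \<Longrightarrow> j \<in> pverts D \<Longrightarrow> i \<noteq> j \<Longrightarrow> (i, j) \<in> parcs D \<or> (j, i) \<in> parcs D"
  shows "tight d D f"
proof -
  interpret pair_digraph D by fact
  have "card (out_nbrs D v) = f v" if v: "v \<in> pverts D" for v
  proof -
    have "{w \<in> pverts D. f w < f v} \<subseteq> out_nbrs D v"
    proof
      fix w assume "w \<in> {w \<in> pverts D. f w < f v}"
      then have w: "w \<in> pverts D" "f w < f v" by auto
      then have "(w, v) \<notin> parcs D" using f by (auto simp: ranking_def)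
      then show "w \<in> out_nbrs D v" using complete[OF v w(1)] w(2) by (auto simp: out_nbrs_def)
    qed
    then have "out_nbrs D v = {w \<in> pverts D. f w < f v}" using out_nbrs_earlier[OF f] by blast
    then show ?thesis using card_earlier[OF f v] by simp
  qed
  then show ?thesis by (simp add: tight_def)
qed

lemma pair_digraph_subgraph:
  assumes "pair_digraph D" and "subgraph (with_proj H) (with_proj D)"
  shows "pair_digraph H"
proof -
  interpret pair_digraph D by fact
  have H: "pverts H \<subseteq> pverts D" "parcs H \<subseteq> parcs D" "wf_digraph (with_proj H)"
    using assms(2) by (simp_all add: subgraph_def)
  show ?thesis
  proof (intro pair_digraph.intro pair_fin_digraph.intro pair_fin_digraph_axioms.intro
      pair_loopfree_digraph.intro pair_loopfree_digraph_axioms.intro)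
    show "pair_wf_digraph H" "pair_wf_digraph H" using H(3) by (simp_all only: wf_digraph_wp_iff)
    show "finite (pverts H)" using H(1) pair_finite_verts by (rule finite_subset)
    show "finite (parcs H)" using H(2) pair_finite_arcs by (rule finite_subset)
    show "fst e \<noteq> snd e" if "e \<in> parcs H" for e using H(2) that pair_no_loops by blast
  qed
qed

text \<open>A single extension of the complete graph on the first \<open>d\<close> vertices suffices. That this graph is admissible is an
  instance of the theorem on tight rankings, as complete graphs are rigid and their rankings are tight.\<close>

lemma tight_imp_base:
  fixes D :: "'v pair_pre_digraph"
  assumes "pair_digraph D" and acyclic: "acyclic_digraph (with_proj D)"
    and f: "ranking D f" and n: "CARD('d::finite) \<le> card (pverts D)" and tight: "tight TYPE('d) D f"
  shows "\<exists>H. subgraph (with_proj H) (with_proj D) \<and>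
    complete_digraph CARD('d) (with_proj (mk_symmetric (with_proj H))) \<and>
    stable_root_extension TYPE('d) H D"
proof -
  interpret pair_digraph D by fact
  define U where "U = {v \<in> pverts D. f v < CARD('d)}"
  define H where "H = \<lparr>pverts = U, parcs = {e \<in> parcs D. fst e \<in> U \<and> snd e \<in> U}\<rparr>"
  have H: "pverts H = U" "parcs H = {e \<in> parcs D. fst e \<in> U \<and> snd e \<in> U}" by (simp_all add: H_def)
  have f_arc: "\<And>v w. (v, w) \<in> parcs D \<Longrightarrow> f w < f v"
    using f by (auto simp: ranking_def)
  have "wf_digraph (with_proj H)" by unfold_locales (auto simp: H)
  moreover have "wf_digraph (with_proj D)" by (rule wf_digraph)
  ultimately have sub: "subgraph (with_proj H) (with_proj D)"
    unfolding subgraph_def by (auto simp: H U_def compatible_def)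
  interpret H: pair_digraph H using pair_digraph sub by (rule pair_digraph_subgraph)
  have bijU: "bij_betw f U {..<CARD('d)}"
    unfolding U_def by (rule ranking_initial_segment[OF f n])
  then have injU: "inj_on f U" and cU: "card U = CARD('d)"
    using bij_betw_same_card[of f U "{..<CARD('d)}"] by (simp_all add: bij_betw_def)
  have f_H: "ranking H f"
    using bijU f_arc by (auto simp: ranking_def H cU)
  have "(v, w) \<in> parcs D" if "v \<in> U" "w \<in> U" "f w < f v" for v w
  proof -
    have "w \<in> out_nbrs D v"
      using tight_imp_out_nbrs_eq[OF f tight, of v] that by (simp add: U_def)
    then show ?thesis by (simp add: out_nbrs_def)
  qed
  then have complete: "(i, j) \<in> parcs H \<or> (j, i) \<in> parcs H" if "i \<in> U" "j \<in> U" "i \<noteq> j" for i j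
    using that inj_onD[OF injU, of i j] by (cases "f i" "f j" rule: linorder_cases) (auto simp: H)
  let ?S = "mk_symmetric (with_proj H)"
  have S: "parcs ?S = {(u, v). (u, v) \<in> pverts ?S \<times> pverts ?S \<and> u \<noteq> v}"
    using complete H.no_loops' by (fastforce simp: parcs_mk_symmetric H)
  then have "complete_digraph CARD('d) (with_proj ?S)"
    unfolding complete_digraph_pair_def using cU pair_finite_verts by (auto simp: H U_def)
  moreover have "admissible TYPE('d) H"
    using H.admissible_iff_tight[OF rigid_complete f_H] complete_imp_tight[OF H.pair_digraph f_H] complete cU S
    by (auto simp: H)
  moreover have "root_extension H D"
    unfolding root_extension_def
  proof (intro conjI)
    show "induced_subgraph (with_proj H) (with_proj D)"
      using sub by (auto simp: induced_subgraph_def H)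
    have "arcs_ends (with_proj D \<restriction> (pverts D - pverts H)) \<subseteq> parcs D"
      by (auto simp: arcs_ends_def arc_to_ends_def)
    then show "acyclic_digraph (with_proj D \<restriction> (pverts D - pverts H))"
      using acyclic by (auto simp: acyclic_digraph_def intro: acyclic_subset)
    show "\<not> (\<exists>u\<in>pverts H. \<exists>v\<in>pverts D - pverts H. (u, v) \<in> parcs D)"
      using f_arc by (force simp: H U_def)
  qed
  moreover have "CARD('d) \<le> out_degree (with_proj D) v" if "v \<in> pverts D - pverts H" for v
    using tight that by (fastforce simp: tight_def out_degree_eq H U_def)
  ultimately show ?thesis using sub unfolding stable_root_extension_def by blast
qed

theorem mainTheorem7:
  fixes G D :: "'v pair_pre_digraph"
  assumes "pair_graph G"
    and "rigid TYPE('d::finite) G"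
    and "card (pverts G) \<ge> CARD('d)"
    and "orientation_of D G"
    and "acyclic_digraph (with_proj D)"
  shows "(admissible TYPE('d) D \<longleftrightarrow> defect TYPE('d) D = (CARD('d) + 1) choose 2) \<and>
         (defect TYPE('d) D = (CARD('d) + 1) choose 2 \<longleftrightarrow>
           (\<exists>H. subgraph (with_proj H) (with_proj D) \<and>
                complete_digraph CARD('d) (with_proj (mk_symmetric (with_proj H))) \<and>
                (stable_root_extension TYPE('d))\<^sup>*\<^sup>* H D))"
proof -
  have D: "pair_digraph D" and sym: "mk_symmetric (with_proj D) = G"
    using assms(4) by (simp_all add: orientation_of_def)
  interpret pair_digraph D by (rule D)
  have n: "CARD('d) \<le> card (pverts D)" using assms(3) by (simp flip: sym)
  obtain f where f: "ranking D f" using acyclic_imp_ex_ranking[OF D assms(5)] by blast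
  have "admissible TYPE('d) D \<longleftrightarrow> tight TYPE('d) D f"
    using assms(2) by (intro admissible_iff_tight[OF _ f n]) (simp add: sym)
  moreover have "defect TYPE('d) D = (CARD('d) + 1) choose 2"
    if H: "subgraph (with_proj H) (with_proj D)"
      "complete_digraph CARD('d) (with_proj (mk_symmetric (with_proj H)))"
      "(stable_root_extension TYPE('d))\<^sup>*\<^sup>* H D" for H
  proof -
    interpret H: pair_digraph H using D H(1) by (rule pair_digraph_subgraph)
    have "acyclic_digraph (with_proj H)"
      using assms(5) H(1) by (auto simp: acyclic_digraph_def subgraph_def intro: acyclic_subset)
    then obtain g where g: "ranking H g" using acyclic_imp_ex_ranking H.pair_digraph by blast
    have c: "card (pverts H) = CARD('d)"
      "parcs (mk_symmetric (with_proj H)) = {(u, v). (u, v) \<in> pverts H \<times> pverts H \<and> u \<noteq> v}"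
      using H(2) by (simp_all add: complete_digraph_pair_def)
    have "(i, j) \<in> parcs H \<or> (j, i) \<in> parcs H" if "i \<in> pverts H" "j \<in> pverts H" "i \<noteq> j" for i j
    proof -
      have "(i, j) \<in> parcs (mk_symmetric (with_proj H))" using c(2) that by simp
      then show ?thesis by (auto simp: parcs_mk_symmetric)
    qed
    then have "tight TYPE('d) H g" using H.pair_digraph g by (rule complete_imp_tight[rotated 2])
    then have "defect TYPE('d) H = (CARD('d) + 1) choose 2"
      using H.defect_eq_iff_tight[OF g, where ?'d = 'd] c(1) by simp
    then show ?thesis using defect_stable_root_extensions[OF H(3) pair_finite_verts] by simp
  qed
  ultimately show ?thesis
    using defect_eq_iff_tight[OF f n] tight_imp_base[OF D assms(5) f n] by blast
qed

end
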